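(* Let $\mathbb{k}$ be a field, $n\ge2$, $S=\mathbb{k}[x_1,\ldots,x_n]$, and let $I\subset S$ be the ideal generated by all square-free monomials of degree $n-1$. Then for every integer $k\ge1$ and every $1\le i\le n$, the Betti numbers of $S/I^k$ are given by $$\beta_i(S/I^k)=\binom{n+k-i}{n-1}\binom{n-1}{i-1}.$$
   Context: For a homogeneous ideal $J\subset S$ (standard grading), the Betti numbers $\beta_i(S/J)$ are the ranks of the free modules in a minimal graded free resolution $0\to S^{\beta_n}\to\cdots\to S^{\beta_1}\to S\to S/J\to 0$. Convention: $\binom{j}{i}=0$ when $i>j$. *)

theory Defs
  imports "HOL-Library.Cardinality" "HOL-Library.Poly_Mapping" "Jordan_Normal_Form.Matrix_Kernel"
begin

text \<open>The polynomial ring over \<open>'k\<close> in finitely many variables, indexed by the finite type \<open>'v\<close>;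
  the number of variables is \<open>CARD('v)\<close>.\<close>

type_synonym ('v, 'k) mpolynomial = "('v \<Rightarrow>\<^sub>0 nat) \<Rightarrow>\<^sub>0 'k"

global_interpretation self_module: Modules.module "(*) :: 'a::comm_ring_1 \<Rightarrow> 'a \<Rightarrow> 'a"
  defines ideal_generated_by = self_module.span
  by unfold_locales (simp_all add: algebra_simps)

fun ideal_power :: "'a::comm_ring_1 set \<Rightarrow> nat \<Rightarrow> 'a set" where
  "ideal_power I 0 = UNIV"
| "ideal_power I (Suc k) = ideal_generated_by {a * b | a b. a \<in> I \<and> b \<in> ideal_power I k}"

definition mono_degree :: "('v::finite \<Rightarrow>\<^sub>0 nat) \<Rightarrow> nat" where
  "mono_degree m = (\<Sum>v\<in>UNIV. Poly_Mapping.lookup m v)"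

definition squarefree_mono :: "('v \<Rightarrow>\<^sub>0 nat) \<Rightarrow> bool" where
  "squarefree_mono m \<longleftrightarrow> (\<forall>v. Poly_Mapping.lookup m v \<le> 1)"

definition squarefree_ideal :: "nat \<Rightarrow> ('v::finite, 'k::comm_ring_1) mpolynomial set" where
  "squarefree_ideal d =
     ideal_generated_by {Poly_Mapping.single m 1 | m. squarefree_mono m \<and> mono_degree m = d}"

definition irrelevant_ideal :: "('v, 'k::comm_ring_1) mpolynomial set" where
  "irrelevant_ideal =
     ideal_generated_by (range (\<lambda>v. Poly_Mapping.single (Poly_Mapping.single v 1) 1))"

text \<open>The degree is an integer since degrees of matrix entries are differences of shifts;
  zero is homogeneous of every degree, and is the only such element in a negative degree.\<close>

definition homogeneous_of_degree :: "int \<Rightarrow> ('v::finite, 'k::zero) mpolynomial \<Rightarrow> bool" where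
  "homogeneous_of_degree e p \<longleftrightarrow> (\<forall>m\<in>Poly_Mapping.keys p. int (mono_degree m) = e)"

definition mat_image :: "'a::comm_ring_1 mat \<Rightarrow> 'a vec set" where
  "mat_image A = (\<lambda>v. A *\<^sub>v v) ` carrier_vec (dim_col A)"

text \<open>A graded free resolution of \<open>S/J\<close> by finitely generated modules, with homogeneous bases chosen:
  \<open>F\<^sub>i\<close> is the direct sum of the \<open>S(- d i b)\<close> for \<open>b < r i\<close>, and \<open>D i\<close> is the matrix of the
  degree-preserving differential from \<open>F\<^sub>i\<^sub>+\<^sub>1\<close> to \<open>F\<^sub>i\<close>, acting on column vectors.
  The augmentation is the canonical map from \<open>F\<^sub>0 = S\<close> onto \<open>S/J\<close>, so exactness at \<open>F\<^sub>0\<close> says that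
  \<open>D 0\<close> has image \<open>J\<close>. No bound on the length is imposed.\<close>

definition graded_free_resolution ::
    "('v::finite, 'k::comm_ring_1) mpolynomial set \<Rightarrow> (nat \<Rightarrow> nat) \<Rightarrow> (nat \<Rightarrow> nat \<Rightarrow> int) \<Rightarrow>
     (nat \<Rightarrow> ('v, 'k) mpolynomial mat) \<Rightarrow> bool" where
  "graded_free_resolution J r d D \<longleftrightarrow>
     r 0 = 1 \<and> d 0 0 = 0 \<and>
     (\<forall>i. D i \<in> carrier_mat (r i) (r (Suc i))) \<and>
     (\<forall>i. \<forall>a<r i. \<forall>b<r (Suc i). homogeneous_of_degree (d (Suc i) b - d i a) (D i $$ (a, b))) \<and>
     (\<lambda>v. v $ 0) ` mat_image (D 0) = J \<and>
     (\<forall>i. mat_kernel (D i) = mat_image (D (Suc i)))"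

definition minimal_graded_free_resolution ::
    "('v::finite, 'k::comm_ring_1) mpolynomial set \<Rightarrow> (nat \<Rightarrow> nat) \<Rightarrow> (nat \<Rightarrow> nat \<Rightarrow> int) \<Rightarrow>
     (nat \<Rightarrow> ('v, 'k) mpolynomial mat) \<Rightarrow> bool" where
  "minimal_graded_free_resolution J r d D \<longleftrightarrow>
     graded_free_resolution J r d D \<and>
     (\<forall>i. \<forall>a<r i. \<forall>b<r (Suc i). D i $$ (a, b) \<in> irrelevant_ideal)"

text \<open>The Betti number \<open>\<beta>\<^sub>i(S/J)\<close>, for a proper homogeneous ideal \<open>J\<close> over a field. (The unit ideal
  has no minimal resolution with \<open>F\<^sub>0 = S\<close>.)\<close>

definition betti_number :: "('v::finite, 'k::field) mpolynomial set \<Rightarrow> nat \<Rightarrow> nat" where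
  "betti_number J i = (THE b. \<exists>r d D. minimal_graded_free_resolution J r d D \<and> r i = b)"

end

theory Submission
  imports Defs
begin

text \<open>
  Write \<open>f\<^sub>v\<close> for the product of all variables except \<open>x\<^sub>v\<close>. The ideal \<open>I\<close> is of linear type: the kernel of
  \<open>S[T] \<rightarrow> S[t]\<close>, \<open>T\<^sub>v \<mapsto> f\<^sub>v t\<close>, is generated by the \<open>n - 1\<close> elements \<open>x\<^sub>v T\<^sub>v - x\<^sub>w T\<^sub>w\<close> with \<open>w\<close> fixed, and these form a
  regular sequence. Hence their Koszul complex over \<open>S[T]\<close> resolves the Rees algebra of \<open>I\<close>, and its strand of
  \<open>T\<close>-degree \<open>k\<close> resolves \<open>I\<^sup>k\<close> over \<open>S\<close>. The term of homological degree \<open>j\<close> in that strand has as basis the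
  monomials of degree \<open>k - j\<close> in \<open>T\<close> times the \<open>j\<close>-subsets of an \<open>(n - 1)\<close>-set, and the differentials are linear
  in the \<open>x\<^sub>v\<close>, so the resolution is minimal. Ranks in a minimal resolution are unique because comparison maps
  between two of them become mutually inverse modulo the irrelevant ideal.
\<close>

section \<open>Uniqueness of the ranks in a minimal resolution\<close>

lemma exists_right_factor:
  fixes B C :: "'a::comm_ring_1 mat"
  assumes B: "B \<in> carrier_mat m p" and C: "C \<in> carrier_mat m q"
    and cols: "\<And>j. j < q \<Longrightarrow> col C j \<in> mat_image B"
  shows "\<exists>X\<in>carrier_mat p q. C = B * X"
proof -
  have "\<forall>j. \<exists>w. j < q \<longrightarrow> w \<in> carrier_vec p \<and> col C j = B *\<^sub>v w"
    using cols B unfolding mat_image_def by fastforce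
  then obtain w where w: "\<And>j. j < q \<Longrightarrow> w j \<in> carrier_vec p"
    and Cw: "\<And>j. j < q \<Longrightarrow> col C j = B *\<^sub>v w j"
    by metis
  define X where "X = mat_of_cols p (map w [0..<q])"
  have X: "X \<in> carrier_mat p q"
    by (simp add: X_def mat_of_cols_def)
  have colX: "col X j = w j" if "j < q" for j
    unfolding X_def using that w by (subst col_mat_of_cols) auto
  have "C = B * X"
  proof (rule eq_matI)
    fix i j assume ij: "i < dim_row (B * X)" "j < dim_col (B * X)"
    then have "C $$ (i, j) = col C j $ i"
      using B C X by auto
    also have "\<dots> = (B *\<^sub>v col X j) $ i"
      using ij Cw colX X by auto
    also have "\<dots> = (B * X) $$ (i, j)"
      using ij by auto
    finally show "C $$ (i, j) = (B * X) $$ (i, j)" .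
  qed (use B C X in auto)
  with X show ?thesis by blast
qed

lemma mult_mat_unit_vec:
  fixes A :: "'a::comm_ring_1 mat"
  assumes "A \<in> carrier_mat n m" and "j < m"
  shows "A *\<^sub>v unit_vec m j = col A j"
  using assms by (intro eq_vecI) auto

text \<open>Exactness at a free module in the form used for lifting: every column of
  \<open>C\<close> is a cycle, hence a boundary. Both the comparison maps and the homotopies come
  from it.\<close>

lemma mult_eq_zero_imp_factor:
  fixes A B C :: "'a::comm_ring_1 mat"
  assumes A: "A \<in> carrier_mat n m" and B: "B \<in> carrier_mat m p" and C: "C \<in> carrier_mat m q"
    and sub: "mat_kernel A \<subseteq> mat_image B" and "A * C = 0\<^sub>m n q"
  shows "\<exists>X\<in>carrier_mat p q. C = B * X"
proof (rule exists_right_factor[OF B C])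
  fix j assume j: "j < q"
  have "A *\<^sub>v col C j = col (A * C) j"
    using A C j by (intro eq_vecI) auto
  also have "\<dots> = 0\<^sub>v n"
    using assms(5) j by auto
  finally have "col C j \<in> mat_kernel A"
    using A C j by (intro mat_kernelI) auto
  then show "col C j \<in> mat_image B"
    using sub by blast
qed

text \<open>If \<open>m < n\<close>, padding \<open>A\<close> by zero columns and \<open>B\<close>
  by zero rows to size \<open>n\<close> keeps the product, but the padded \<open>B\<close> has a
  zero row, so the determinant of the identity would be 0.\<close>

lemma right_inverse_imp_rows_le_cols:
  fixes A B :: "'a::idom mat"
  assumes A: "A \<in> carrier_mat n m" and B: "B \<in> carrier_mat m n" and AB: "A * B = 1\<^sub>m n"
  shows "n \<le> m"
proof (rule ccontr)
  assume "\<not> n \<le> m"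
  then have mn: "m < n" by simp
  define A' where "A' = mat n n (\<lambda>(i, j). if j < m then A $$ (i, j) else 0)"
  define B' where "B' = mat n n (\<lambda>(i, j). if i < m then B $$ (i, j) else 0)"
  have A': "A' \<in> carrier_mat n n" and B': "B' \<in> carrier_mat n n"
    by (auto simp: A'_def B'_def)
  have "A' * B' = A * B"
  proof (rule eq_matI)
    fix i j assume ij: "i < dim_row (A * B)" "j < dim_col (A * B)"
    then have ij': "i < n" "j < n" using A B by auto
    have "(A' * B') $$ (i, j) = (\<Sum>l = 0..<n. if l < m then A $$ (i, l) * B $$ (l, j) else 0)"
      using ij' A' B' by (auto simp: scalar_prod_def A'_def B'_def intro!: sum.cong)
    also have "\<dots> = (\<Sum>l = 0..<m. A $$ (i, l) * B $$ (l, j))"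
      using mn by (intro sum.mono_neutral_cong_right) auto
    also have "\<dots> = (A * B) $$ (i, j)"
      using ij' A B by (auto simp: scalar_prod_def)
    finally show "(A' * B') $$ (i, j) = (A * B) $$ (i, j)" .
  qed (use A B A' B' in auto)
  then have "det A' * det B' = 1"
    using AB A' B' det_mult[OF A' B'] by simp
  moreover have "B' = mat\<^sub>r n n (\<lambda>i. if i = m then 0\<^sub>v n else row B' i)"
    using mn by (intro eq_matI) (auto simp: B'_def)
  then have "det B' = 0"
    using det_row_0[OF mn, of "row B'"] B' by (auto simp: Pi_def)
  ultimately show False by simp
qed

section \<open>Reduction modulo the irrelevant ideal\<close>

abbreviation const_coeff :: "(('v \<Rightarrow>\<^sub>0 nat) \<Rightarrow>\<^sub>0 'k::comm_ring_1) \<Rightarrow> 'k" where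
  "const_coeff p \<equiv> Poly_Mapping.lookup p 0"

lemma poly_mapping_nat_add_eq_0_iff:
  fixes a b :: "'v \<Rightarrow>\<^sub>0 nat"
  shows "a + b = 0 \<longleftrightarrow> a = 0 \<and> b = 0"
  by (auto simp: poly_mapping_eq_iff lookup_add fun_eq_iff)

text \<open>Exponents are natural numbers, so a product of two monomials is constant only if both
  factors are.\<close>

lemma const_coeff_mult: "const_coeff (p * q) = const_coeff p * const_coeff q"
proof -
  have 1: "(Poly_Mapping.lookup q b when (0::'b \<Rightarrow>\<^sub>0 nat) = a + b)
      = ((Poly_Mapping.lookup q b when a = 0) when b = 0)" for a b
    using poly_mapping_nat_add_eq_0_iff[of a b] by (auto simp: when_def)
  have "const_coeff (p * q) = (\<Sum>a. Poly_Mapping.lookup p a * (const_coeff q when a = 0))"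
    unfolding lookup_mult 1 Sum_any_when_equal ..
  also have "\<dots> = (\<Sum>a. (Poly_Mapping.lookup p a * const_coeff q when a = 0))"
    by (simp add: mult_when)
  finally show ?thesis by simp
qed

global_interpretation const_coeff: comm_ring_hom const_coeff
  by unfold_locales (auto simp: lookup_add const_coeff_mult)

lemma const_coeff_irrelevant_ideal:
  assumes "p \<in> irrelevant_ideal"
  shows "const_coeff p = 0"
  using assms unfolding irrelevant_ideal_def
proof (induction rule: self_module.span_induct_alt)
  case (step c x y)
  then obtain v where "x = Poly_Mapping.single (Poly_Mapping.single v 1) 1" by auto
  moreover have "Poly_Mapping.single v (1::nat) \<noteq> 0"
    by (metis lookup_single_eq lookup_zero one_neq_zero)
  ultimately have "const_coeff x = 0"
    by (metis lookup_single_not_eq)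
  with step show ?case
    by (simp add: lookup_add const_coeff_mult)
qed simp


lemma map_const_coeff_eq_0:
  assumes "A \<in> carrier_mat n m" and "\<And>a b. a < n \<Longrightarrow> b < m \<Longrightarrow> A $$ (a, b) \<in> irrelevant_ideal"
  shows "map_mat const_coeff A = 0\<^sub>m n m"
  using assms by (intro eq_matI) (auto simp: const_coeff_irrelevant_ideal)

section \<open>Comparison of minimal resolutions\<close>

lemma minimal_resolutionD:
  assumes "minimal_graded_free_resolution J r d D"
  shows "r 0 = 1" and "D i \<in> carrier_mat (r i) (r (Suc i))"
    and "(\<lambda>v. v $ 0) ` mat_image (D 0) = J" and "mat_kernel (D i) = mat_image (D (Suc i))"
    and "map_mat const_coeff (D i) = 0\<^sub>m (r i) (r (Suc i))"
  using assms unfolding minimal_graded_free_resolution_def graded_free_resolution_def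
  by (auto intro!: map_const_coeff_eq_0)

lemma resolution_mult_eq_0:
  assumes "minimal_graded_free_resolution J r d D"
  shows "D i * D (Suc i) = 0\<^sub>m (r i) (r (Suc (Suc i)))"
proof (rule eq_matI)
  note D = minimal_resolutionD[OF assms]
  note [simp] = carrier_matD[OF D(2)]
  fix a b assume ab: "a < dim_row (0\<^sub>m (r i) (r (Suc (Suc i))))" "b < dim_col (0\<^sub>m (r i) (r (Suc (Suc i))))"
  then have "D (Suc i) *\<^sub>v unit_vec (r (Suc (Suc i))) b \<in> mat_image (D (Suc i))"
    unfolding mat_image_def by auto
  then have "D i *\<^sub>v (D (Suc i) *\<^sub>v unit_vec (r (Suc (Suc i))) b) = 0\<^sub>v (r i)"
    using D(4)[of i] mat_kernelD(2)[OF D(2)] by blast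
  moreover have "D (Suc i) *\<^sub>v unit_vec (r (Suc (Suc i))) b = col (D (Suc i)) b"
    using ab D(2)[of "Suc i"] by (intro mult_mat_unit_vec) auto
  ultimately have "D i *\<^sub>v col (D (Suc i)) b = 0\<^sub>v (r i)"
    by simp
  then have "(D i *\<^sub>v col (D (Suc i)) b) $ a = 0"
    using ab by simp
  then show "(D i * D (Suc i)) $$ (a, b) = 0\<^sub>m (r i) (r (Suc (Suc i))) $$ (a, b)"
    using ab by auto
qed (use minimal_resolutionD(2)[OF assms] in auto)

text \<open>A chain endomorphism over the identity is homotopic to the identity, and the homotopy terms vanish modulo
  the irrelevant ideal because the differentials do. The homotopy is carried along as the pair \<open>h\<close>, \<open>g\<close>,
  where \<open>g\<close> stands for the composite of the previous homotopy with the differential.\<close>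

lemma chain_endomorphism_const_coeff:
  assumes res: "minimal_graded_free_resolution J r d D"
    and T: "\<And>i. T i \<in> carrier_mat (r i) (r i)" and T0: "T 0 = 1\<^sub>m 1"
    and comm: "\<And>i. T i * D i = D i * T (Suc i)"
  shows "map_mat const_coeff (T i) = 1\<^sub>m (r i)"
proof -
  note D = minimal_resolutionD[OF res]
  have "\<exists>h g. h \<in> carrier_mat (r (Suc i)) (r i) \<and> g \<in> carrier_mat (r i) (r i) \<and>
      T i = 1\<^sub>m (r i) + (D i * h + g) \<and> g * D i = 0\<^sub>m (r i) (r (Suc i)) \<and>
      map_mat const_coeff g = 0\<^sub>m (r i) (r i)"
  proof (induction i)
    case 0
    \<comment> \<open>In degree 0 the map is already the identity, so \<open>h\<close> and
      \<open>g\<close> both start at zero.\<close>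
    have "T 0 = 1\<^sub>m (r 0) + (D 0 * 0\<^sub>m (r (Suc 0)) (r 0) + 0\<^sub>m (r 0) (r 0))"
      using D(1) T0 D(2)[of 0] by auto
    moreover have "0\<^sub>m (r 0) (r 0) * D 0 = 0\<^sub>m (r 0) (r (Suc 0))"
      using D(2)[of 0] by simp
    moreover have "map_mat const_coeff (0\<^sub>m (r 0) (r 0)) = 0\<^sub>m (r 0) (r 0)"
      by (intro eq_matI) auto
    ultimately show ?case
      by (metis zero_carrier_mat)
  next
    case (Suc i)
    then obtain h g where h: "h \<in> carrier_mat (r (Suc i)) (r i)" and g: "g \<in> carrier_mat (r i) (r i)"
      and Ti: "T i = 1\<^sub>m (r i) + (D i * h + g)" and gD: "g * D i = 0\<^sub>m (r i) (r (Suc i))"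
      by blast
    let ?n = "r (Suc i)" and ?m = "r i"
    note Di = D(2)[of i] and TS = T[of "Suc i"]
    \<comment> \<open>\<open>X\<close> is the part of \<open>T (Suc i)\<close> minus the identity
      that \<open>h * D i\<close> does not account for. It is killed by \<open>D i\<close>, so it
      factors through \<open>D (Suc i)\<close>, which yields the next \<open>h'\<close>; the next
      \<open>g\<close> is \<open>h * D i\<close>.\<close>
    define X where "X = T (Suc i) - (1\<^sub>m ?n + h * D i)"
    have hD: "h * D i \<in> carrier_mat ?n ?n" using h Di by auto
    have X: "X \<in> carrier_mat ?n ?n"
      unfolding X_def using hD by (intro minus_carrier_mat) auto
    have "D i * X = D i * T (Suc i) - (D i * 1\<^sub>m ?n + D i * (h * D i))"
      unfolding X_def using hD Di TS by (simp add: mult_minus_distrib_mat mult_add_distrib_mat[OF Di one_carrier_mat hD])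
    also have "D i * T (Suc i) = D i + (D i * h * D i + 0\<^sub>m ?m ?n)"
      unfolding comm[symmetric] Ti gD[symmetric] using Di h g
      by (simp add: add_mult_distrib_mat[of _ ?m ?m _ _ ?n])
    also have "D i * 1\<^sub>m ?n + D i * (h * D i) = D i + D i * h * D i"
      using Di h assoc_mult_mat[OF Di h Di] by simp
    also have "D i + (D i * h * D i + 0\<^sub>m ?m ?n) - (D i + D i * h * D i) = 0\<^sub>m ?m ?n"
      using Di h by (intro eq_matI) auto
    finally have "D i * X = 0\<^sub>m ?m ?n" .
    then obtain h' where h': "h' \<in> carrier_mat (r (Suc (Suc i))) ?n" and Xh: "X = D (Suc i) * h'"
      using mult_eq_zero_imp_factor[OF Di D(2)[of "Suc i"] X] D(4)[of i] by blast
    have "T (Suc i) = 1\<^sub>m ?n + (X + h * D i)"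
      unfolding X_def using TS hD by (intro eq_matI) auto
    moreover have "h * D i * D (Suc i) = 0\<^sub>m ?n (r (Suc (Suc i)))"
      using assoc_mult_mat[OF h Di D(2)[of "Suc i"]] resolution_mult_eq_0[OF res, of i] h by simp
    moreover have "map_mat const_coeff (h * D i) = 0\<^sub>m ?n ?n"
      using const_coeff.mat_hom_mult[OF h Di] D(5)[of i] h by simp
    ultimately show ?case
      using h' hD Xh by blast
  qed
  then obtain h g where h: "h \<in> carrier_mat (r (Suc i)) (r i)" and g: "g \<in> carrier_mat (r i) (r i)"
    and Ti: "T i = 1\<^sub>m (r i) + (D i * h + g)" and g0: "map_mat const_coeff g = 0\<^sub>m (r i) (r i)"
    by blast
  have "map_mat const_coeff (D i * h) = 0\<^sub>m (r i) (r i)"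
    using const_coeff.mat_hom_mult[OF D(2)[of i] h] D(5)[of i] h by simp
  moreover have "map_mat const_coeff (T i) =
      map_mat const_coeff (1\<^sub>m (r i)) + (map_mat const_coeff (D i * h) + map_mat const_coeff g)"
    unfolding Ti using D(2)[of i] h g
    by (intro eq_matI) (auto simp: lookup_add)
  ultimately show ?thesis
    using g0 by (simp add: const_coeff.mat_hom_one)
qed

lemma exists_chain_map:
  assumes res: "minimal_graded_free_resolution J r d D"
    and res': "minimal_graded_free_resolution J r' d' D'"
  shows "\<exists>F. (\<forall>i. F i \<in> carrier_mat (r' i) (r i)) \<and> F 0 = 1\<^sub>m 1 \<and> (\<forall>i. F i * D i = D' i * F (Suc i))"
proof -
  note D = minimal_resolutionD[OF res] and D' = minimal_resolutionD[OF res']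
  \<comment> \<open>Besides the shape of \<open>X\<close>, the invariant records that
    \<open>D' j\<close> kills \<open>X * D i\<close>, which is what the next lift needs. For
    \<open>i = 0\<close> the common image \<open>J\<close> of \<open>D 0\<close> and
    \<open>D' 0\<close> takes that role.\<close>
  define P where "P i X \<longleftrightarrow> X \<in> carrier_mat (r' i) (r i) \<and> (i = 0 \<longrightarrow> X = 1\<^sub>m 1) \<and>
      (\<forall>j. i = Suc j \<longrightarrow> D' j * (X * D i) = 0\<^sub>m (r' j) (r (Suc i)))" for i X
  have start: "P 0 (1\<^sub>m 1)"
    using D(1) D'(1) by (auto simp: P_def)
  have step: "\<exists>Y. P (Suc i) Y \<and> X * D i = D' i * Y" if "P i X" for i X
  proof -
    have X: "X \<in> carrier_mat (r' i) (r i)" using that by (simp add: P_def)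
    have XD: "X * D i \<in> carrier_mat (r' i) (r (Suc i))" using X D(2)[of i] by simp
    have "\<exists>Y\<in>carrier_mat (r' (Suc i)) (r (Suc i)). X * D i = D' i * Y"
    proof (cases i)
      case 0
      have X1: "X * D i = D i" using that D(1) D(2)[of i] 0 by (simp add: P_def)
      show ?thesis unfolding X1
      proof (rule exists_right_factor[OF D'(2)])
        show "D i \<in> carrier_mat (r' i) (r (Suc i))" using XD X1 by simp
        fix j assume j: "j < r (Suc i)"
        have c: "col (D 0) j = D 0 *\<^sub>v unit_vec (r (Suc 0)) j"
          using D(2)[of 0] j 0 by (metis mult_mat_unit_vec)
        then have "col (D 0) j $ 0 \<in> (\<lambda>v. v $ 0) ` mat_image (D 0)"
          using carrier_matD[OF D(2)[of 0]] by (auto simp: mat_image_def)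
        then obtain w where w: "w \<in> mat_image (D' 0)" "col (D 0) j $ 0 = w $ 0"
          unfolding D(3) D'(3)[symmetric] by auto
        \<comment> \<open>Both vectors have length \<open>r 0 = r' 0 = 1\<close>, so their single
          entry determines them.\<close>
        have "col (D 0) j = w"
          using w D(1) D'(1) carrier_matD[OF D(2)[of 0]] carrier_matD[OF D'(2)[of 0]]
          by (intro eq_vecI) (auto simp: mat_image_def)
        with w 0 show "col (D i) j \<in> mat_image (D' i)" by simp
      qed
    next
      case (Suc j)
      have "D' j * (X * D i) = 0\<^sub>m (r' j) (r (Suc i))"
        using that Suc by (simp add: P_def)
      then show ?thesis
        using mult_eq_zero_imp_factor[OF _ _ XD, of "D' j" "r' j" "D' i" "r' (Suc i)"] D'(2,4) Suc
        by (metis order_refl)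
    qed
    then obtain Y where Y: "Y \<in> carrier_mat (r' (Suc i)) (r (Suc i))" and XY: "X * D i = D' i * Y"
      by blast
    have "D' i * (Y * D (Suc i)) = X * (D i * D (Suc i))"
      using assoc_mult_mat[OF D'(2) Y D(2)] assoc_mult_mat[OF X D(2) D(2)] XY by simp
    also have "\<dots> = 0\<^sub>m (r' i) (r (Suc (Suc i)))"
      using resolution_mult_eq_0[OF res, of i] X by simp
    finally show ?thesis
      using Y XY by (auto simp: P_def)
  qed
  obtain F where "\<And>i. P i (F i)" "\<And>i. F i * D i = D' i * F (Suc i)" and "F 0 = 1\<^sub>m 1"
    using dependent_nat_choice[of P "\<lambda>i X Y. X * D i = D' i * Y"] start step
    by (metis P_def)
  then show ?thesis
    unfolding P_def by blast
qed

text \<open>Comparison maps in both directions compose to a chain endomorphism over the identity,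
  which becomes the identity modulo the irrelevant ideal. So the reduced \<open>G i\<close> and
  \<open>F i\<close> are one-sided inverses over the field.\<close>

lemma minimal_resolution_rank_le:
  fixes J :: "('v::finite, 'k::field) mpolynomial set"
  assumes res: "minimal_graded_free_resolution J r d D"
    and res': "minimal_graded_free_resolution J r' d' D'"
  shows "r i \<le> r' i"
proof -
  note D = minimal_resolutionD[OF res] and D' = minimal_resolutionD[OF res']
  obtain F where F: "\<And>i. F i \<in> carrier_mat (r' i) (r i)" "F 0 = 1\<^sub>m 1"
    "\<And>i. F i * D i = D' i * F (Suc i)"
    using exists_chain_map[OF res res'] by blast
  obtain G where G: "\<And>i. G i \<in> carrier_mat (r i) (r' i)" "G 0 = 1\<^sub>m 1"
    "\<And>i. G i * D' i = D i * G (Suc i)"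
    using exists_chain_map[OF res' res] by blast
  have "map_mat const_coeff (G i * F i) = 1\<^sub>m (r i)"
  proof (rule chain_endomorphism_const_coeff[OF res])
    show "G i * F i \<in> carrier_mat (r i) (r i)" for i
      using F(1)[of i] G(1)[of i] by simp
    show "G 0 * F 0 = 1\<^sub>m 1"
      using F(2) G(2) by simp
    show "G i * F i * D i = D i * (G (Suc i) * F (Suc i))" for i
      using assoc_mult_mat[OF G(1) F(1) D(2), of i] assoc_mult_mat[OF G(1) D'(2) F(1), of i]
        assoc_mult_mat[OF D(2) G(1) F(1), of i] F(3)[of i] G(3)[of i] by simp
  qed
  then have "map_mat const_coeff (G i) * map_mat const_coeff (F i) = 1\<^sub>m (r i)"
    using const_coeff.mat_hom_mult[OF G(1) F(1)] by metis
  then show ?thesis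
    by (rule right_inverse_imp_rows_le_cols[rotated 2]) (use F(1) G(1) in auto)
qed

lemma betti_number_eq:
  fixes J :: "('v::finite, 'k::field) mpolynomial set"
  assumes "minimal_graded_free_resolution J r d D"
  shows "betti_number J i = r i"
  unfolding betti_number_def
  using assms minimal_resolution_rank_le by (intro the_equality) (blast intro: order.antisym)+

section \<open>Koszul complexes\<close>

text \<open>The Koszul differential in coordinates: \<open>c A\<close> is the coefficient of the
  basis vector \<open>e_A\<close>, and the sign is the position of \<open>s\<close> within
  \<open>insert s B\<close>. Chains are total functions; homological degree enters only through the
  cardinality of the sets at which they are evaluated.\<close>

definition koszul :: "nat \<Rightarrow> (nat \<Rightarrow> 'a::comm_ring_1) \<Rightarrow> (nat set \<Rightarrow> 'a) \<Rightarrow> nat set \<Rightarrow> 'a" where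
  "koszul m z c B = (\<Sum>s\<in>{..<m} - B. (-1) ^ card (B \<inter> {..<s}) * z s * c (insert s B))"

text \<open>With \<open>koszul_Suc_insert\<close>, this presents the complex on \<open>Suc m\<close>
  elements as the mapping cone of multiplication by \<open>z m\<close>, up to sign, on the complex
  on \<open>m\<close> elements. The inductions on \<open>m\<close> below rest on it.\<close>

lemma koszul_Suc_notin:
  assumes "B \<subseteq> {..<m}"
  shows "koszul (Suc m) z c B = koszul m z c B + (-1) ^ card B * z m * c (insert m B)"
proof -
  have "{..<Suc m} - B = insert m ({..<m} - B)" and "B \<inter> {..<m} = B"
    using assms by auto
  then show ?thesis
    by (simp add: koszul_def add.commute)
qed

lemma koszul_Suc_insert:
  assumes "B \<subseteq> {..<m}"
  shows "koszul (Suc m) z c (insert m B) = koszul m z (\<lambda>A. c (insert m A)) B"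
proof -
  have 1: "{..<Suc m} - insert m B = {..<m} - B"
    by auto
  have 2: "insert m B \<inter> {..<s} = B \<inter> {..<s}" if "s < m" for s
    using that by auto
  show ?thesis
    unfolding koszul_def 1
    by (intro sum.cong) (auto simp: 2 insert_commute)
qed

lemma koszul_cong:
  assumes "\<And>s. s < m \<Longrightarrow> s \<notin> B \<Longrightarrow> c (insert s B) = c' (insert s B)"
  shows "koszul m z c B = koszul m z c' B"
  unfolding koszul_def using assms by (intro sum.cong) auto

lemma koszul_cong_card:
  assumes "\<And>A. A \<subseteq> {..<m} \<Longrightarrow> card A = Suc j \<Longrightarrow> c A = c' A" and "B \<subseteq> {..<m}" and "card B = j"
  shows "koszul m z c B = koszul m z c' B"
proof (rule koszul_cong)
  fix s assume s: "s < m" "s \<notin> B"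
  have "finite B"
    using assms(2) finite_subset by blast
  then show "c (insert s B) = c' (insert s B)"
    using assms(2,3) s by (intro assms(1)) auto
qed

lemma koszul_add: "koszul m z (\<lambda>A. c A + c' A) B = koszul m z c B + koszul m z c' B"
  by (simp add: koszul_def distrib_left sum.distrib)

lemma koszul_mult: "koszul m z (\<lambda>A. a * c A) B = a * koszul m z c B"
  unfolding koszul_def sum_distrib_left by (intro sum.cong refl mult.left_commute)

lemma koszul_sum: "koszul m z (\<lambda>A. \<Sum>x\<in>X. c x A) B = (\<Sum>x\<in>X. koszul m z (c x) B)"
  unfolding koszul_def sum_distrib_left by (rule sum.swap)

lemma koszul_koszul:
  assumes "B \<subseteq> {..<m}"
  shows "koszul m z (koszul m z c) B = 0"
  using assms
proof (induction m arbitrary: c B)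
  case 0
  then show ?case by (simp add: koszul_def)
next
  case (Suc m)
  show ?case
  proof (cases "m \<in> B")
    case True
    define B' where "B' = B - {m}"
    have B: "B = insert m B'" and B': "B' \<subseteq> {..<m}"
      using True Suc.prems by (auto simp: B'_def lessThan_Suc)
    have "koszul (Suc m) z (koszul (Suc m) z c) B =
        koszul m z (\<lambda>A. koszul (Suc m) z c (insert m A)) B'"
      unfolding B using B' by (rule koszul_Suc_insert)
    also have "\<dots> = koszul m z (koszul m z (\<lambda>A. c (insert m A))) B'"
      using B' by (intro koszul_cong koszul_Suc_insert) auto
    finally show ?thesis
      using Suc.IH[OF B'] by simp
  next
    case False
    then have B: "B \<subseteq> {..<m}"
      using Suc.prems by (auto simp: lessThan_Suc)
    then have fin: "finite B"
      using finite_subset by blast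
    \<comment> \<open>Passing from \<open>B\<close> to \<open>insert s B\<close> flips the sign of
      the \<open>z m\<close> term. This makes it cancel against the term through
      \<open>insert m B\<close>.\<close>
    have "koszul m z (koszul (Suc m) z c) B =
        koszul m z (\<lambda>A. koszul m z c A + (- ((-1) ^ card B * z m)) * c (insert m A)) B"
    proof (rule koszul_cong)
      fix s assume "s < m" "s \<notin> B"
      then show "koszul (Suc m) z c (insert s B) =
          koszul m z c (insert s B) + (- ((-1) ^ card B * z m)) * c (insert m (insert s B))"
        using B fin by (subst koszul_Suc_notin) auto
    qed
    also have "\<dots> = - ((-1) ^ card B * z m * koszul m z (\<lambda>A. c (insert m A)) B)"
      unfolding koszul_add koszul_mult using Suc.IH[OF B] by simp
    finally show ?thesis
      by (simp add: koszul_Suc_notin[OF B] koszul_Suc_insert[OF B])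
  qed
qed

text \<open>The operators \<open>\<sigma> s\<close> play the role of division by \<open>z s\<close> with remainder. The part of a cycle that involves the
  last generator is bounded by dividing the remaining part by \<open>z m\<close>.\<close>

lemma koszul_exact:
  fixes z :: "nat \<Rightarrow> 'a::comm_ring_1" and \<sigma> :: "nat \<Rightarrow> 'a \<Rightarrow> 'a"
  assumes add: "\<And>s p q. s < m \<Longrightarrow> \<sigma> s (p + q) = \<sigma> s p + \<sigma> s q"
    and cancel: "\<And>s p. s < m \<Longrightarrow> \<sigma> s (z s * p) = p"
    and commute: "\<And>s t p. s < m \<Longrightarrow> t < m \<Longrightarrow> s \<noteq> t \<Longrightarrow> \<sigma> s (z t * p) = z t * \<sigma> s p"
    and "\<And>B. B \<subseteq> {..<m} \<Longrightarrow> card B = j \<Longrightarrow> koszul m z c B = 0"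
  shows "\<exists>c'. \<forall>A. A \<subseteq> {..<m} \<longrightarrow> card A = Suc j \<longrightarrow> c A = koszul m z c' A"
  using assms
proof (induction m arbitrary: c)
  case 0
  then show ?case by auto
next
  case (Suc m)
  note add = Suc.prems(1) and cancel = Suc.prems(2) and commute = Suc.prems(3)
    and cycle = Suc.prems(4)
  have zero: "\<sigma> m 0 = 0"
    using add[of m 0 0] by simp
  have neg: "\<sigma> m (- p) = - \<sigma> m p" for p
    using add[of m p "- p"] zero by (metis lessI add.right_inverse minus_unique)
  have sign: "\<sigma> m ((-1) ^ e * p) = (-1) ^ e * \<sigma> m p" for e p
    by (cases "even e") (auto simp: neg)
  have sum: "\<sigma> m (\<Sum>s\<in>X. f s) = (\<Sum>s\<in>X. \<sigma> m (f s))" for X :: "nat set" and f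
    by (induction X rule: infinite_finite_induct) (simp_all add: zero add)
  have \<sigma>_koszul: "\<sigma> m (koszul m z c B) = koszul m z (\<lambda>A. \<sigma> m (c A)) B" for c B
    unfolding koszul_def sum mult.assoc sign
    by (intro sum.cong refl) (simp add: commute)
  define b where "b A = - ((-1) ^ j) * \<sigma> m (c A)" for A
  \<comment> \<open>\<open>b\<close> will be placed on the sets containing \<open>m\<close>;
    \<open>a\<close> is what the first \<open>m\<close> elements must then still bound. It is a
    cycle for them, so the induction hypothesis applies.\<close>
  define a where "a A = c A + (-1) ^ j * z m * b A" for A
  \<comment> \<open>Applying \<open>\<sigma> m\<close> to the cycle equation at \<open>B\<close>
    strips \<open>z m\<close> from the last term and passes through the remaining ones.\<close>
  have bd: "c (insert m B) = koszul m z b B" if B: "B \<subseteq> {..<m}" "card B = j" for B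
  proof -
    have "0 = \<sigma> m (koszul (Suc m) z c B)"
      using cycle[of B] B zero by (simp add: lessThan_Suc subset_insertI2)
    also have "\<dots> = koszul m z (\<lambda>A. \<sigma> m (c A)) B + (-1) ^ j * c (insert m B)"
      unfolding koszul_Suc_notin[OF B(1)] B(2) mult.assoc add[OF lessI] \<sigma>_koszul sign cancel[OF lessI] ..
    finally have eq: "(-1) ^ j * c (insert m B) = - koszul m z (\<lambda>A. \<sigma> m (c A)) B"
      by (simp only: eq_neg_iff_add_eq_0 add.commute)
    have "c (insert m B) = (-1) ^ j * ((-1) ^ j * c (insert m B))"
      by (cases "even j") simp_all
    then show ?thesis
      unfolding eq b_def koszul_mult by simp
  qed
  have "koszul m z a B = 0" if B: "B \<subseteq> {..<m}" "card B = j" for B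
  proof -
    have "koszul m z a B = koszul m z c B + (-1) ^ j * z m * koszul m z b B"
      unfolding a_def koszul_add koszul_mult ..
    also have "\<dots> = koszul (Suc m) z c B"
      using bd[OF B] koszul_Suc_notin[OF B(1), of z c] B(2) by simp
    also have "\<dots> = 0"
      using cycle[of B] B by (simp add: lessThan_Suc subset_insertI2)
    finally show ?thesis .
  qed
  then obtain a' where a': "\<And>A. A \<subseteq> {..<m} \<Longrightarrow> card A = Suc j \<Longrightarrow> a A = koszul m z a' A"
    using Suc.IH[of a] add cancel commute by (metis less_SucI)
  define c' where "c' A = (if m \<in> A then b (A - {m}) else a' A)" for A
  have "c A = koszul (Suc m) z c' A" if A: "A \<subseteq> {..<Suc m}" "card A = Suc j" for A
  proof (cases "m \<in> A")
    case True
    define B where "B = A - {m}"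
    have AB: "A = insert m B" and B: "B \<subseteq> {..<m}" "card B = j"
      using True A by (auto simp: B_def lessThan_Suc)
    have "koszul (Suc m) z c' A = koszul m z b B"
      unfolding AB koszul_Suc_insert[OF B(1)]
    proof (rule koszul_cong)
      fix s assume "s < m" "s \<notin> B"
      then have "insert m (insert s B) - {m} = insert s B"
        using B by auto
      then show "c' (insert m (insert s B)) = b (insert s B)"
        by (simp add: c'_def)
    qed
    then show ?thesis
      using bd[OF B] AB by simp
  next
    case False
    then have B: "A \<subseteq> {..<m}"
      using A by (auto simp: lessThan_Suc)
    have "koszul m z c' A = koszul m z a' A"
      using B by (intro koszul_cong) (auto simp: c'_def)
    moreover have "c' (insert m A) = b A"
      using False by (simp add: c'_def)
    ultimately have "koszul (Suc m) z c' A = a A - (-1) ^ j * z m * b A"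
      using a'[OF B A(2)] koszul_Suc_notin[OF B, of z c'] A(2) by simp
    then show ?thesis
      by (simp add: a_def)
  qed
  then show ?case by blast
qed

section \<open>The Rees ideal\<close>

lemma mono_degree_add [simp]: "mono_degree (a + b) = mono_degree a + mono_degree b"
  by (simp add: mono_degree_def lookup_add sum.distrib)

lemma mono_degree_single [simp]: "mono_degree (Poly_Mapping.single v e) = e"
  by (simp add: mono_degree_def lookup_single when_def)

lemma mono_degree_0 [simp]: "mono_degree 0 = 0"
  by (simp add: mono_degree_def)

lemma lookup_le_mono_degree: "Poly_Mapping.lookup b v \<le> mono_degree b"
  unfolding mono_degree_def by (rule member_le_sum) auto

text \<open>Prescribes a map on single terms; the result is additive as soon as each
  \<open>F a\<close> is additive in the coefficient.\<close>

definition extend :: "('a \<Rightarrow> 'b::zero \<Rightarrow> 'c::comm_monoid_add) \<Rightarrow> ('a \<Rightarrow>\<^sub>0 'b) \<Rightarrow> 'c" where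
  "extend F p = (\<Sum>a\<in>Poly_Mapping.keys p. F a (Poly_Mapping.lookup p a))"

lemma extend_single:
  assumes "F a 0 = 0"
  shows "extend F (Poly_Mapping.single a c) = F a c"
  using assms by (simp add: extend_def)

lemma additive_extend:
  fixes F :: "'a \<Rightarrow> 'b::ab_group_add \<Rightarrow> 'c::ab_group_add"
  assumes "\<And>a. Modules.additive (F a)"
  shows "Modules.additive (extend F)"
proof
  fix p q :: "'a \<Rightarrow>\<^sub>0 'b"
  show "extend F (p + q) = extend F p + extend F q"
    unfolding extend_def
    using assms by (intro setsum_keys_plus_distrib) (simp_all add: additive.zero additive.add)
qed

lemma poly_mapping_sum_singles:
  "p = (\<Sum>a\<in>Poly_Mapping.keys p. Poly_Mapping.single a (Poly_Mapping.lookup p a))"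
  by (rule poly_mapping_eqI)
    (auto simp: lookup_sum lookup_single when_def in_keys_iff sum.delta)

abbreviation expo :: "'v \<Rightarrow> 'v \<Rightarrow>\<^sub>0 nat" where
  "expo v \<equiv> Poly_Mapping.single v 1"

text \<open>\<open>S[T]\<close> is encoded as the polynomials in \<open>T\<close> with coefficients in \<open>S\<close>; \<open>bimono b a c\<close> is \<open>c x\<^sup>a T\<^sup>b\<close>.\<close>

type_synonym ('v, 'k) mpoly2 = "('v \<Rightarrow>\<^sub>0 nat) \<Rightarrow>\<^sub>0 ('v, 'k) mpolynomial"

definition bimono :: "('v \<Rightarrow>\<^sub>0 nat) \<Rightarrow> ('v \<Rightarrow>\<^sub>0 nat) \<Rightarrow> 'k::zero \<Rightarrow> ('v, 'k) mpoly2" where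
  "bimono b a c = Poly_Mapping.single b (Poly_Mapping.single a c)"

lemma bimono_0 [simp]: "bimono b a 0 = 0"
  by (simp add: bimono_def)

lemma bimono_add: "bimono b a (c + d) = bimono b a c + bimono b a (d::'k::monoid_add)"
  by (simp add: bimono_def single_add)

lemma bimono_mult: "bimono b a c * bimono b' a' d = bimono (b + b') (a + a') (c * (d::'k::comm_ring_1))"
  by (simp add: bimono_def mult_single)

text \<open>Only exponents \<open>b\<close> occurring in \<open>p\<close> need to be treated, so a
  restriction on the \<open>T\<close>-degree of \<open>p\<close> is available for each
  monomial.\<close>

lemma bimono_induct [case_names bimono zero add]:
  fixes p :: "('v, 'k::comm_ring_1) mpoly2"
  assumes mono: "\<And>b a c. b \<in> Poly_Mapping.keys p \<Longrightarrow> P (bimono b a c)"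
    and zero: "P 0" and add: "\<And>p q. P p \<Longrightarrow> P q \<Longrightarrow> P (p + q)"
  shows "P p"
proof -
  have sum: "P (sum f X)" if "\<And>x. x \<in> X \<Longrightarrow> P (f x)" for f :: "('v \<Rightarrow>\<^sub>0 nat) \<Rightarrow> _" and X
    using that by (induction X rule: infinite_finite_induct) (simp_all add: zero add)
  have "P (Poly_Mapping.single b q)" if "b \<in> Poly_Mapping.keys p" for b q
  proof -
    have "additive (Poly_Mapping.single b :: ('v, 'k) mpolynomial \<Rightarrow> _)"
      by unfold_locales (simp add: single_add)
    then have "Poly_Mapping.single b q =
        (\<Sum>a\<in>Poly_Mapping.keys q. bimono b a (Poly_Mapping.lookup q a))"
      unfolding bimono_def by (subst poly_mapping_sum_singles[of q]) (rule additive.sum)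
    then show ?thesis
      using sum mono that by simp
  qed
  then show ?thesis
    by (subst poly_mapping_sum_singles[of p]) (rule sum)
qed

lemma additive_eqI:
  fixes f g :: "('v, 'k::comm_ring_1) mpoly2 \<Rightarrow> 'c::ab_group_add"
  assumes f: "additive f" and g: "additive g"
    and "\<And>b a c. b \<in> Poly_Mapping.keys p \<Longrightarrow> f (bimono b a c) = g (bimono b a c)"
  shows "f p = g p"
  by (rule bimono_induct[where P = "\<lambda>p. f p = g p"])
    (simp_all add: assms(3) additive.zero[OF f] additive.zero[OF g] additive.add[OF f] additive.add[OF g])

lemma additive_mult: "additive f \<Longrightarrow> additive (\<lambda>p. f (a * p))" for a :: "'a::comm_ring_1"
  by (simp add: additive_def distrib_left)

lemma additive_mult_left: "additive f \<Longrightarrow> additive (\<lambda>p. a * f p)" for a :: "'a::comm_ring_1"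
  by (simp add: additive_def distrib_left)

lemma additive_id: "additive (\<lambda>p. p)"
  by (simp add: additive_def)

section \<open>Division by differences of the \<open>xT v\<close>\<close>

definition xT :: "'v \<Rightarrow> ('v, 'k::comm_ring_1) mpoly2" where
  "xT v = bimono (expo v) (expo v) 1"

lemma xT_bimono: "xT v * bimono b a c = bimono (expo v + b) (expo v + a) c"
  by (simp add: xT_def bimono_mult)

text \<open>Division by \<open>xT v - xT w\<close>, read as a polynomial in \<open>xT v\<close>: with \<open>e = min (b v) (a v)\<close> a monomial is
  \<open>m * xT v ^ e\<close>, and its quotient is \<open>m * (xT v ^ e - xT w ^ e) / (xT v - xT w)\<close>.\<close>

definition xT_quot_mono :: "'v \<Rightarrow> 'v \<Rightarrow> ('v \<Rightarrow>\<^sub>0 nat) \<Rightarrow> ('v \<Rightarrow>\<^sub>0 nat) \<Rightarrow> 'k::comm_ring_1 \<Rightarrow> ('v, 'k) mpoly2" where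
  "xT_quot_mono w v b a c =
     (\<Sum>l<min (Poly_Mapping.lookup b v) (Poly_Mapping.lookup a v).
        bimono (b - Poly_Mapping.single v (Suc l) + Poly_Mapping.single w l)
               (a - Poly_Mapping.single v (Suc l) + Poly_Mapping.single w l) c)"

definition xT_quot :: "'v \<Rightarrow> 'v \<Rightarrow> ('v, 'k::comm_ring_1) mpoly2 \<Rightarrow> ('v, 'k) mpoly2" where
  "xT_quot w v = extend (\<lambda>b. extend (xT_quot_mono w v b))"

lemma additive_xT_quot: "additive (xT_quot w v :: ('v, 'k::comm_ring_1) mpoly2 \<Rightarrow> _)"
  unfolding xT_quot_def
proof (intro additive_extend)
  show "additive (xT_quot_mono w v b a :: 'k \<Rightarrow> _)" for b a
    by unfold_locales (simp add: xT_quot_mono_def bimono_add sum.distrib)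
qed

lemma xT_quot_bimono: "xT_quot w v (bimono b a c) = xT_quot_mono w v b a c"
  unfolding xT_quot_def bimono_def
  by (subst extend_single; (subst extend_single)?) (auto simp: xT_quot_mono_def extend_def)

lemma min_lookup_expo:
  "min (Poly_Mapping.lookup (expo t + b) v) (Poly_Mapping.lookup (expo t + a) v) =
     (if t = v then Suc (min (Poly_Mapping.lookup b v) (Poly_Mapping.lookup a v))
      else min (Poly_Mapping.lookup b v) (Poly_Mapping.lookup a v))"
  by (auto simp: lookup_add lookup_single)

text \<open>The number of summands depends on the exponents at \<open>v\<close> only, so a factor
  \<open>xT t\<close> with \<open>t \<noteq> v\<close> can be pulled out; \<open>t = w\<close> is
  allowed.\<close>

lemma xT_quot_commute_xT:
  fixes p :: "('v, 'k::comm_ring_1) mpoly2"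
  assumes "t \<noteq> v"
  shows "xT_quot w v (xT t * p) = xT t * xT_quot w v p"
proof (rule additive_eqI[where p = p])
  show "additive (\<lambda>p. xT_quot w v (xT t * p) :: ('v, 'k) mpoly2)"
    by (rule additive_mult[OF additive_xT_quot])
  show "additive (\<lambda>p. xT t * xT_quot w v p :: ('v, 'k) mpoly2)"
    by (rule additive_mult_left[OF additive_xT_quot])
  fix b a :: "'v \<Rightarrow>\<^sub>0 nat" and c :: 'k
  have 1: "expo t + d - Poly_Mapping.single v l + Poly_Mapping.single w l' =
      expo t + (d - Poly_Mapping.single v l + Poly_Mapping.single w l')" for d l l'
    using assms by (intro poly_mapping_eqI) (auto simp: lookup_add lookup_minus lookup_single when_def)
  show "xT_quot w v (xT t * bimono b a c) = xT t * xT_quot w v (bimono b a c)"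
    unfolding xT_bimono xT_quot_bimono xT_quot_mono_def min_lookup_expo sum_distrib_left 1
    using assms by simp
qed

lemma xT_quot_commute:
  assumes "t \<noteq> v" and "v \<noteq> w"
  shows "xT_quot w v ((xT t - xT w) * p) = (xT t - xT w) * xT_quot w v p"
  using assms xT_quot_commute_xT[of t v w p] xT_quot_commute_xT[of w v w p]
  by (simp add: left_diff_distrib additive.diff[OF additive_xT_quot])

lemma xT_quot_cancel:
  fixes p :: "('v, 'k::comm_ring_1) mpoly2"
  assumes "v \<noteq> w"
  shows "xT_quot w v ((xT v - xT w) * p) = p"
proof (rule additive_eqI[where p = p])
  show "additive (\<lambda>p. xT_quot w v ((xT v - xT w) * p) :: ('v, 'k) mpoly2)"
    by (rule additive_mult[OF additive_xT_quot])
  fix b a :: "'v \<Rightarrow>\<^sub>0 nat" and c :: 'k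
  define e where "e = min (Poly_Mapping.lookup b v) (Poly_Mapping.lookup a v)"
  \<comment> \<open>For \<open>l \<le> e\<close>, \<open>f l\<close> is the monomial with
    \<open>l\<close> factors \<open>xT v\<close> replaced by \<open>xT w\<close>. Multiplication by
    \<open>xT v\<close> gives the sum over \<open>l \<le> e\<close>, multiplication by
    \<open>xT w\<close> the same sum without \<open>l = 0\<close>; the difference is
    \<open>f 0\<close>.\<close>
  define f where "f l = bimono (b - Poly_Mapping.single v l + Poly_Mapping.single w l)
      (a - Poly_Mapping.single v l + Poly_Mapping.single w l) c" for l
  have 1: "expo v + d - Poly_Mapping.single v (Suc l) = d - Poly_Mapping.single v l" for d l
    by (intro poly_mapping_eqI) (auto simp: lookup_add lookup_minus lookup_single when_def)
  have 2: "expo w + d - Poly_Mapping.single v (Suc l) + Poly_Mapping.single w l =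
      d - Poly_Mapping.single v (Suc l) + Poly_Mapping.single w (Suc l)" for d l
    using assms by (intro poly_mapping_eqI) (auto simp: lookup_add lookup_minus lookup_single when_def)
  have "xT_quot w v (xT v * bimono b a c) = (\<Sum>l<Suc e. f l)"
    unfolding xT_bimono xT_quot_bimono xT_quot_mono_def min_lookup_expo 1 f_def e_def by simp
  moreover have "xT_quot w v (xT w * bimono b a c) = (\<Sum>l<e. f (Suc l))"
    unfolding xT_bimono xT_quot_bimono xT_quot_mono_def min_lookup_expo 2 f_def e_def using assms by simp
  ultimately have "xT_quot w v ((xT v - xT w) * bimono b a c) = f 0"
    by (simp add: left_diff_distrib additive.diff[OF additive_xT_quot] sum.lessThan_Suc_shift
        del: sum.lessThan_Suc)
  then show "xT_quot w v ((xT v - xT w) * bimono b a c) = bimono b a c"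
    by (simp add: f_def)
qed (rule additive_id)

section \<open>The Rees map and its kernel\<close>

text \<open>The exponent of the product of the \<open>f\<^sub>v\<close> to the powers \<open>b v\<close>.\<close>

definition gen_exp :: "('v::finite \<Rightarrow>\<^sub>0 nat) \<Rightarrow> 'v \<Rightarrow>\<^sub>0 nat" where
  "gen_exp b = Abs_poly_mapping (\<lambda>v. mono_degree b - Poly_Mapping.lookup b v)"

lemma lookup_gen_exp: "Poly_Mapping.lookup (gen_exp b) v = mono_degree b - Poly_Mapping.lookup b v"
  by (simp add: gen_exp_def)

lemma gen_exp_0 [simp]: "gen_exp 0 = 0"
  by (rule poly_mapping_eqI) (simp add: lookup_gen_exp)

lemma gen_exp_add: "gen_exp (b + b') = gen_exp b + gen_exp b'"
proof (rule poly_mapping_eqI)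
  show "Poly_Mapping.lookup (gen_exp (b + b')) v = Poly_Mapping.lookup (gen_exp b + gen_exp b') v" for v
    using lookup_le_mono_degree[of b v] lookup_le_mono_degree[of b' v]
    by (simp add: lookup_gen_exp lookup_add)
qed

text \<open>The map to the Rees algebra followed by \<open>t = 1\<close>. On elements of a single
  \<open>T\<close>-degree this loses nothing.\<close>

definition rees_map :: "('v::finite, 'k::comm_ring_1) mpoly2 \<Rightarrow> ('v, 'k) mpolynomial" where
  "rees_map = extend (\<lambda>b q. q * Poly_Mapping.single (gen_exp b) 1)"

lemma additive_rees_map: "additive rees_map"
  unfolding rees_map_def by (intro additive_extend) (simp add: additive_def distrib_right)

lemma rees_map_bimono: "rees_map (bimono b a c) = Poly_Mapping.single (a + gen_exp b) c"
  by (simp add: rees_map_def bimono_def extend_single mult_single)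

text \<open>Both sides are the exponent of the product of all variables, so all \<open>xT v\<close>
  have the same image.\<close>

lemma expo_add_gen_exp:
  "expo v + gen_exp (expo v) = expo w + gen_exp (expo w)"
  by (rule poly_mapping_eqI) (auto simp: lookup_add lookup_gen_exp lookup_single when_def)

lemma rees_map_xT_diff: "rees_map ((xT v - xT w) * p) = 0"
proof (rule additive_eqI[where p = p and g = "\<lambda>_. 0"])
  show "additive (\<lambda>p. rees_map ((xT v - xT w) * p))"
    by (rule additive_mult[OF additive_rees_map])
  fix b a :: "'a \<Rightarrow>\<^sub>0 nat" and c :: 'b
  have "expo u + a + gen_exp (expo u + b) = (expo u + gen_exp (expo u)) + (a + gen_exp b)" for u
    unfolding gen_exp_add by (simp add: ac_simps)
  then have "rees_map (xT v * bimono b a c) = rees_map (xT w * bimono b a c)"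
    unfolding xT_bimono rees_map_bimono using expo_add_gen_exp[of v w] by simp
  then show "rees_map ((xT v - xT w) * bimono b a c) = 0"
    by (simp add: left_diff_distrib additive.diff[OF additive_rees_map])
qed (simp add: additive_def)

definition rees_ideal :: "'v::finite \<Rightarrow> ('v, 'k::comm_ring_1) mpoly2 set" where
  "rees_ideal w = ideal_generated_by (range (\<lambda>v. xT v - xT w))"

text \<open>The reference variable \<open>w\<close> cancels in the difference of two generators, so
  any two of the \<open>xT\<close> may be exchanged modulo the ideal.\<close>

lemma xT_diff_in_rees_ideal: "(xT v - xT v') * p \<in> rees_ideal w"
proof -
  have "xT u - xT w \<in> rees_ideal w" for u :: 'a
    unfolding rees_ideal_def by (rule self_module.span_base) auto
  then have "(xT v - xT w) - (xT v' - xT w) \<in> rees_ideal w"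
    unfolding rees_ideal_def by (blast intro: self_module.span_diff)
  then have "p * ((xT v - xT w) - (xT v' - xT w)) \<in> rees_ideal w"
    unfolding rees_ideal_def by (rule self_module.span_scale)
  moreover have "p * ((xT v - xT w) - (xT v' - xT w)) = (xT v - xT v') * p"
    by (simp add: mult.commute)
  ultimately show ?thesis by (simp only:)
qed

text \<open>If \<open>b \<noteq> b'\<close>, some \<open>xT v\<close> divides the first monomial while \<open>b' u > b u\<close> for some \<open>u\<close>; replacing \<open>xT v\<close> by \<open>xT u\<close>
  moves \<open>b\<close> towards \<open>b'\<close>.\<close>

lemma bimono_diff_in_rees_ideal:
  fixes b b' a a' :: "'v::finite \<Rightarrow>\<^sub>0 nat" and c :: "'k::comm_ring_1"
  assumes "mono_degree b = mono_degree b'" and "a + gen_exp b = a' + gen_exp b'"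
  shows "bimono b a c - bimono b' a' c \<in> rees_ideal w"
  using assms
proof (induction "\<Sum>v\<in>UNIV. Poly_Mapping.lookup b v - Poly_Mapping.lookup b' v" arbitrary: b a rule: less_induct)
  case less
  show ?case
  proof (cases "b = b'")
    case True
    with less.prems show ?thesis
      by (simp add: rees_ideal_def self_module.span_zero)
  next
    case False
    let ?l = Poly_Mapping.lookup
    have sum: "sum (?l b) UNIV = sum (?l b') UNIV"
      using less.prems(1) by (simp add: mono_degree_def)
    have 1: "\<exists>v. ?l b v > ?l b' v"
    proof (rule ccontr)
      assume "\<not> ?thesis"
      then have "?l b v = ?l b' v" for v
        using sum_mono_inv[OF sum, of v] by (auto simp: not_less)
      with False show False by (auto intro: poly_mapping_eqI)
    qed
    have 2: "\<exists>v. ?l b v < ?l b' v"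
    proof (rule ccontr)
      assume "\<not> ?thesis"
      then have "?l b v = ?l b' v" for v
        using sum_mono_inv[OF sum[symmetric], of v] by (auto simp: not_less)
      with False show False by (auto intro: poly_mapping_eqI)
    qed
    obtain v u where v: "?l b v > ?l b' v" and u: "?l b u < ?l b' u"
      using 1 2 by blast
    then have uv: "u \<noteq> v" by auto
    have "?l a v + (mono_degree b - ?l b v) = ?l a' v + (mono_degree b - ?l b' v)"
      using arg_cong[OF less.prems(2), of "\<lambda>p. ?l p v"] less.prems(1)
      by (simp add: lookup_add lookup_gen_exp)
    \<comment> \<open>Since \<open>b v > b' v\<close> and the exponents of \<open>x_v\<close> in the
      images agree, \<open>a v\<close> exceeds \<open>a' v\<close>; hence \<open>xT v\<close>
      divides the monomial.\<close>
    then have av: "?l a v \<ge> 1"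
      using v lookup_le_mono_degree[of b v] by linarith
    define b1 where "b1 = b - expo v"
    define a1 where "a1 = a - expo v"
    have b: "b = expo v + b1"
      unfolding b1_def using v
      by (intro poly_mapping_eqI) (auto simp: lookup_add lookup_minus lookup_single when_def)
    have a: "a = expo v + a1"
      unfolding a1_def using av
      by (intro poly_mapping_eqI) (auto simp: lookup_add lookup_minus lookup_single when_def)
    have "bimono (expo u + b1) (expo u + a1) c - bimono b' a' c \<in> rees_ideal w"
    proof (rule less.hyps)
      \<comment> \<open>The measure is the total excess of \<open>b\<close> over \<open>b'\<close>:
        raising the exponent at \<open>u\<close> creates none because \<open>b u < b' u\<close>, and
        lowering it at \<open>v\<close> removes one.\<close>
      have "?l (expo u + b1) x - ?l b' x \<le> ?l b x - ?l b' x" for x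
        using u uv by (auto simp: b lookup_add lookup_single when_def)
      moreover have "?l (expo u + b1) v - ?l b' v < ?l b v - ?l b' v"
        using v uv by (auto simp: b lookup_add lookup_single when_def)
      ultimately show "(\<Sum>x\<in>UNIV. ?l (expo u + b1) x - ?l b' x) < (\<Sum>x\<in>UNIV. ?l b x - ?l b' x)"
        by (intro sum_strict_mono_ex1) auto
      show "mono_degree (expo u + b1) = mono_degree b'"
        using less.prems(1) by (simp add: b)
      have "expo u + a1 + gen_exp (expo u + b1) = expo v + a1 + gen_exp (expo v + b1)"
        unfolding gen_exp_add using expo_add_gen_exp[of u v] by (simp add: ac_simps)
      then show "expo u + a1 + gen_exp (expo u + b1) = a' + gen_exp b'"
        using less.prems(2) by (simp add: a b)
    qed
    moreover have "bimono b a c - bimono (expo u + b1) (expo u + a1) c \<in> rees_ideal w"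
      using xT_diff_in_rees_ideal[of v u "bimono b1 a1 c" w]
      by (simp add: a b left_diff_distrib xT_bimono)
    ultimately show ?thesis
      using self_module.span_add unfolding rees_ideal_def by fastforce
  qed
qed

text \<open>\<open>\<rho>\<close> picks for each monomial in the image one bimonomial of
  \<open>T\<close>-degree \<open>k\<close> above it, and \<open>\<Phi>\<close> extends this choice
  additively. Bimonomials with equal image agree modulo the ideal, so \<open>p\<close> is congruent
  to \<open>\<Phi> (rees_map p)\<close>.\<close>

lemma rees_map_kernel:
  fixes p :: "('v::finite, 'k::comm_ring_1) mpoly2"
  assumes keys: "\<And>b. b \<in> Poly_Mapping.keys p \<Longrightarrow> mono_degree b = k" and "rees_map p = 0"
  shows "p \<in> rees_ideal w"
proof -
  define \<rho> where "\<rho> e = (SOME ba. mono_degree (fst ba) = k \<and> snd ba + gen_exp (fst ba) = e)" for e :: "'v \<Rightarrow>\<^sub>0 nat"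
  define \<Phi> where "\<Phi> = extend (\<lambda>e (c::'k). bimono (fst (\<rho> e)) (snd (\<rho> e)) c)"
  have \<Phi>: "additive \<Phi>"
    unfolding \<Phi>_def by (intro additive_extend) (simp add: additive_def bimono_add)
  have "p - \<Phi> (rees_map p) \<in> rees_ideal w"
  proof (rule bimono_induct[where P = "\<lambda>p. p - \<Phi> (rees_map p) \<in> rees_ideal w"])
    fix b a and c :: 'k
    assume "b \<in> Poly_Mapping.keys p"
    then have b: "mono_degree b = k" by (rule keys)
    have "\<exists>ba. mono_degree (fst ba) = k \<and> snd ba + gen_exp (fst ba) = a + gen_exp b"
      using b by (intro exI[of _ "(b, a)"]) auto
    then have "mono_degree (fst (\<rho> (a + gen_exp b))) = k \<and>
        snd (\<rho> (a + gen_exp b)) + gen_exp (fst (\<rho> (a + gen_exp b))) = a + gen_exp b"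
      unfolding \<rho>_def by (rule someI_ex)
    moreover have "\<Phi> (rees_map (bimono b a c)) =
        bimono (fst (\<rho> (a + gen_exp b))) (snd (\<rho> (a + gen_exp b))) c"
      unfolding rees_map_bimono \<Phi>_def by (simp add: extend_single)
    ultimately show "bimono b a c - \<Phi> (rees_map (bimono b a c)) \<in> rees_ideal w"
      using b by (auto intro!: bimono_diff_in_rees_ideal)
  next
    show "0 - \<Phi> (rees_map 0) \<in> rees_ideal w"
      by (simp add: additive.zero[OF \<Phi>] additive.zero[OF additive_rees_map] rees_ideal_def self_module.span_zero)
  next
    fix p q
    assume "p - \<Phi> (rees_map p) \<in> rees_ideal w" "q - \<Phi> (rees_map q) \<in> rees_ideal w"
    moreover
    have "p + q - \<Phi> (rees_map (p + q)) = (p - \<Phi> (rees_map p)) + (q - \<Phi> (rees_map q))"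
      by (simp add: additive.add[OF \<Phi>] additive.add[OF additive_rees_map])
    ultimately show "p + q - \<Phi> (rees_map (p + q)) \<in> rees_ideal w"
      using self_module.span_add unfolding rees_ideal_def by metis
  qed
  then show ?thesis
    using assms(2) by (simp add: additive.zero[OF \<Phi>])
qed

section \<open>Components of fixed \<open>T\<close>-degree\<close>

text \<open>The degree is an integer so that \<open>q - 1\<close> is correct at
  \<open>q = 0\<close>, where the component is zero.\<close>

definition T_part :: "int \<Rightarrow> ('v::finite, 'k::comm_ring_1) mpoly2 \<Rightarrow> ('v, 'k) mpoly2" where
  "T_part q p = Poly_Mapping.mapp (\<lambda>b c. c when int (mono_degree b) = q) p"

lemma lookup_T_part: "Poly_Mapping.lookup (T_part q p) b = (Poly_Mapping.lookup p b when int (mono_degree b) = q)"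
  by (auto simp: T_part_def lookup_mapp when_def in_keys_iff)

lemma additive_T_part: "additive (T_part q)"
  by unfold_locales (auto intro!: poly_mapping_eqI simp: lookup_T_part lookup_add when_def)

lemma T_part_bimono: "T_part q (bimono b a c) = (bimono b a c when int (mono_degree b) = q)"
  by (rule poly_mapping_eqI) (auto simp: lookup_T_part bimono_def lookup_single when_def)

lemma T_part_xT: "T_part q (xT v * p) = xT v * T_part (q - 1) p"
proof (rule additive_eqI[where p = p])
  show "additive (\<lambda>p. T_part q (xT v * p))"
    by (rule additive_mult[OF additive_T_part])
  show "additive (\<lambda>p. xT v * T_part (q - 1) p)"
    by (rule additive_mult_left[OF additive_T_part])
  show "T_part q (xT v * bimono b a c) = xT v * T_part (q - 1) (bimono b a c)" for b a and c :: 'b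
    by (auto simp: xT_bimono T_part_bimono when_def)
qed

lemma T_part_xT_diff: "T_part q ((xT v - xT w) * p) = (xT v - xT w) * T_part (q - 1) p"
  by (simp add: left_diff_distrib additive.diff[OF additive_T_part] T_part_xT)

section \<open>Powers of the ideal\<close>

text \<open>Coefficients are indexed by \<open>X\<close> and not by the generators, which is the
  shape of a matrix-vector product and of the Koszul differential on 1-chains.\<close>

lemma ideal_generated_by_image:
  fixes g :: "'b \<Rightarrow> 'a::comm_ring_1"
  assumes "finite X"
  shows "ideal_generated_by (g ` X) = range (\<lambda>u. \<Sum>x\<in>X. g x * u x)"
proof (intro subset_antisym subsetI)
  fix p assume "p \<in> ideal_generated_by (g ` X)"
  then show "p \<in> range (\<lambda>u. \<Sum>x\<in>X. g x * u x)"
  proof (induction rule: self_module.span_induct_alt)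
    case base
    show ?case by (rule image_eqI[of _ _ "\<lambda>_. 0"]) simp_all
  next
    case (step c x y)
    then obtain x' u where x': "x' \<in> X" "x = g x'" and u: "y = (\<Sum>x\<in>X. g x * u x)"
      by auto
    have "(\<Sum>x\<in>X. g x * (u x + (if x = x' then c else 0))) =
        (\<Sum>x\<in>X. (if x = x' then c * g x else 0) + g x * u x)"
      by (intro sum.cong refl) (auto simp: distrib_left mult.commute)
    also have "\<dots> = c * x + y"
      unfolding sum.distrib using assms x' u by simp
    finally have "(\<Sum>x\<in>X. g x * (u x + (if x = x' then c else 0))) = c * x + y" .
    then show ?case
      by (intro range_eqI[where x = "\<lambda>x. u x + (if x = x' then c else 0)"]) (rule sym)
  qed
next
  fix p assume "p \<in> range (\<lambda>u. \<Sum>x\<in>X. g x * u x)"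
  then obtain u where p: "p = (\<Sum>x\<in>X. u x * g x)"
    by (auto simp: mult.commute)
  show "p \<in> ideal_generated_by (g ` X)"
    unfolding p by (intro self_module.span_sum self_module.span_scale self_module.span_base) auto
qed

lemma mono_degree_gen_exp:
  "mono_degree (gen_exp b) + mono_degree b = CARD('v) * mono_degree (b :: 'v::finite \<Rightarrow>\<^sub>0 nat)"
proof -
  have "mono_degree (gen_exp b) + mono_degree b =
      (\<Sum>v\<in>UNIV. mono_degree b - Poly_Mapping.lookup b v + Poly_Mapping.lookup b v)"
    unfolding mono_degree_def[of "gen_exp b"] lookup_gen_exp sum.distrib mono_degree_def[of b] ..
  also have "\<dots> = (\<Sum>v\<in>(UNIV::'v set). mono_degree b)"
    by (simp add: lookup_le_mono_degree)
  finally show ?thesis by simp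
qed

lemma mono_degree_eq_0_iff [simp]: "mono_degree b = 0 \<longleftrightarrow> b = 0"
  by (auto simp: mono_degree_def poly_mapping_eq_iff fun_eq_iff)

lemma obtain_expo_add:
  assumes "b \<noteq> (0 :: 'v \<Rightarrow>\<^sub>0 nat)"
  obtains v b' where "b = expo v + b'"
proof -
  obtain v where "Poly_Mapping.lookup b v \<noteq> 0"
    using assms by (auto simp: poly_mapping_eq_iff fun_eq_iff)
  then have "b = expo v + (b - expo v)"
    by (intro poly_mapping_eqI) (auto simp: lookup_add lookup_minus lookup_single when_def)
  then show thesis by (rule that)
qed

lemma squarefree_ideal_codim1:
  "squarefree_ideal (CARD('v) - 1) =
     ideal_generated_by (range (\<lambda>v::'v::finite. Poly_Mapping.single (gen_exp (expo v)) (1::'k::comm_ring_1)))"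
proof -
  have "(squarefree_mono e \<and> mono_degree e = CARD('v) - 1) \<longleftrightarrow> (\<exists>v. e = gen_exp (expo v))"
    for e :: "'v \<Rightarrow>\<^sub>0 nat"
  proof
    assume e: "squarefree_mono e \<and> mono_degree e = CARD('v) - 1"
    then have le: "Poly_Mapping.lookup e u \<le> 1" for u
      by (simp add: squarefree_mono_def)
    have "\<exists>v. Poly_Mapping.lookup e v = 0"
    proof (rule ccontr)
      assume "\<not> ?thesis"
      then have "Poly_Mapping.lookup e u = 1" for u
        using le[of u] by (metis le_neq_implies_less less_one)
      then have "mono_degree e = CARD('v)"
        by (simp add: mono_degree_def)
      with e zero_less_card_finite[where 'a = 'v] show False by linarith
    qed
    then obtain v where v: "Poly_Mapping.lookup e v = 0" by blast
    \<comment> \<open>The \<open>n - 1\<close> exponents away from \<open>v\<close> are at most 1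
      and add up to \<open>n - 1\<close>, so all of them equal 1.\<close>
    have sum: "sum (Poly_Mapping.lookup e) (UNIV - {v}) = (\<Sum>u\<in>UNIV - {v}. 1)"
      using e v by (simp add: mono_degree_def sum.remove[of UNIV v])
    have "Poly_Mapping.lookup e u = 1" if "u \<noteq> v" for u
      using sum_mono_inv[OF sum] le that by simp
    then have "e = gen_exp (expo v)"
      using v by (intro poly_mapping_eqI) (auto simp: lookup_gen_exp lookup_single when_def)
    then show "\<exists>v. e = gen_exp (expo v)" ..
  next
    assume "\<exists>v. e = gen_exp (expo v)"
    then obtain v where e: "e = gen_exp (expo v)" by blast
    show "squarefree_mono e \<and> mono_degree e = CARD('v) - 1"
      using mono_degree_gen_exp[of "expo v"] e
      by (auto simp: squarefree_mono_def lookup_gen_exp)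
  qed
  then have "{Poly_Mapping.single e (1::'k) | e. squarefree_mono e \<and> mono_degree e = CARD('v) - 1} =
      range (\<lambda>v::'v. Poly_Mapping.single (gen_exp (expo v)) 1)"
    by auto
  then show ?thesis
    by (simp add: squarefree_ideal_def)
qed

text \<open>\<open>gen_exp\<close> is additive, so products of generators are generators; conversely
  a monomial of degree \<open>Suc k\<close> in \<open>T\<close> splits off one variable.\<close>

lemma ideal_power_squarefree_ideal_codim1:
  fixes I :: "('v::finite, 'k::comm_ring_1) mpolynomial set"
  assumes I: "I = squarefree_ideal (CARD('v) - 1)"
  shows "ideal_power I k =
    ideal_generated_by ((\<lambda>b. Poly_Mapping.single (gen_exp b) 1) ` {b. mono_degree b = k})"
proof (induction k)
  case 0
  have "x \<in> ideal_generated_by {1}" for x :: "('v, 'k) mpolynomial"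
    using self_module.span_scale[OF self_module.span_base[of 1 "{1}"], of x] by simp
  then show ?case by auto
next
  case (Suc k)
  let ?g = "\<lambda>b::'v \<Rightarrow>\<^sub>0 nat. Poly_Mapping.single (gen_exp b) (1::'k)"
  let ?G = "\<lambda>k. ?g ` {b. mono_degree b = k}"
  have gg: "?g (b + b') = ?g b * ?g b'" for b b'
    by (simp add: mult_single gen_exp_add)
  have "ideal_generated_by {a * b | a b. a \<in> I \<and> b \<in> ideal_generated_by (?G k)} =
      ideal_generated_by (?G (Suc k))"
  proof (rule subset_antisym)
    have "a * b \<in> ideal_generated_by (?G (Suc k))"
      if a: "a \<in> I" and b: "b \<in> ideal_generated_by (?G k)" for a b
      using a unfolding I squarefree_ideal_codim1
    proof (induction rule: self_module.span_induct_alt)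
      case base
      show ?case by (simp add: self_module.span_zero)
    next
      case (step c x y)
      then obtain v where v: "x = ?g (expo v)" by blast
      have "x * b \<in> ideal_generated_by (?G (Suc k))"
        using b
      proof (induction rule: self_module.span_induct_alt)
        case base
        show ?case by (simp add: self_module.span_zero)
      next
        case (step c' x' y')
        then obtain b' where b': "mono_degree b' = k" "x' = ?g b'" by blast
        have "x * x' \<in> ideal_generated_by (?G (Suc k))"
          unfolding v b'(2) gg[symmetric]
          by (rule self_module.span_base) (use b'(1) in auto)
        then have "c' * (x * x') + x * y' \<in> ideal_generated_by (?G (Suc k))"
          using step by (blast intro: self_module.span_add self_module.span_scale)
        moreover have "c' * (x * x') + x * y' = x * (c' * x' + y')"
          unfolding distrib_left mult.left_commute[of c'] ..
        ultimately show ?case by (simp only:)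
      qed
      then have "c * (x * b) + y * b \<in> ideal_generated_by (?G (Suc k))"
        using step by (blast intro: self_module.span_add self_module.span_scale)
      then show ?case
        unfolding distrib_right mult.assoc .
    qed
    then show "ideal_generated_by {a * b | a b. a \<in> I \<and> b \<in> ideal_generated_by (?G k)} \<subseteq>
        ideal_generated_by (?G (Suc k))"
      by (intro self_module.span_minimal self_module.subspace_span) auto
    have "?G (Suc k) \<subseteq> {a * b | a b. a \<in> I \<and> b \<in> ideal_generated_by (?G k)}"
    proof
      fix p assume "p \<in> ?G (Suc k)"
      then obtain b where b: "mono_degree b = Suc k" "p = ?g b" by blast
      then have "b \<noteq> 0" by auto
      then obtain v b' where vb: "b = expo v + b'" by (rule obtain_expo_add)
      have "?g (expo v) \<in> I"
        unfolding I squarefree_ideal_codim1 by (rule self_module.span_base) blast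
      moreover have "?g b' \<in> ideal_generated_by (?G k)"
        by (rule self_module.span_base) (use b vb in auto)
      moreover have "p = ?g (expo v) * ?g b'"
        unfolding b(2) vb gg ..
      ultimately show "p \<in> {a * b | a b. a \<in> I \<and> b \<in> ideal_generated_by (?G k)}"
        by blast
    qed
    then show "ideal_generated_by (?G (Suc k)) \<subseteq>
        ideal_generated_by {a * b | a b. a \<in> I \<and> b \<in> ideal_generated_by (?G k)}"
      by (rule self_module.span_mono)
  qed
  then show ?case
    using Suc by simp
qed

text \<open>Stars and bars, after listing the exponents along an enumeration of the
  variables.\<close>

lemma card_mono_degree_eq:
  "card {b :: 'v::finite \<Rightarrow>\<^sub>0 nat. mono_degree b = q} = (q + CARD('v) - 1) choose q"
proof -
  let ?n = "CARD('v)"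
  obtain en :: "nat \<Rightarrow> 'v" where en: "bij_betw en {0..<?n} UNIV"
    using ex_bij_betw_nat_finite[of "UNIV :: 'v set"] by auto
  define f where "f b = map (\<lambda>s. Poly_Mapping.lookup b (en s)) [0..<?n]" for b :: "'v \<Rightarrow>\<^sub>0 nat"
  have sum: "sum_list (f b) = mono_degree b" for b
    unfolding f_def mono_degree_def
    by (simp add: interv_sum_list_conv_sum_set_nat sum.reindex_bij_betw[OF en])
  have "bij_betw f {b. mono_degree b = q} {l. length l = ?n \<and> sum_list l = q}"
  proof (intro bij_betw_imageI inj_onI)
    fix b b' assume "f b = f b'"
    then have eq: "Poly_Mapping.lookup b (en s) = Poly_Mapping.lookup b' (en s)" if "s < ?n" for s
      using that by (simp add: f_def map_eq_conv)
    show "b = b'"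
    proof (rule poly_mapping_eqI)
      fix v
      have "v \<in> en ` {0..<?n}" using en by (simp add: bij_betw_def)
      then show "Poly_Mapping.lookup b v = Poly_Mapping.lookup b' v"
        using eq by auto
    qed
  next
    show "f ` {b. mono_degree b = q} = {l. length l = ?n \<and> sum_list l = q}"
    proof (intro subset_antisym subsetI)
      fix l assume "l \<in> f ` {b. mono_degree b = q}"
      then show "l \<in> {l. length l = ?n \<and> sum_list l = q}"
        by (auto simp: sum) (simp add: f_def)
    next
      fix l :: "nat list" assume l: "l \<in> {l. length l = ?n \<and> sum_list l = q}"
      define b where "b = Abs_poly_mapping (\<lambda>v. l ! the_inv_into {0..<?n} en v)"
      have "f b = l"
        using l by (intro nth_equalityI) (auto simp: f_def b_def the_inv_into_f_f[OF bij_betw_imp_inj_on[OF en]])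
      then show "l \<in> f ` {b. mono_degree b = q}"
        using l sum[of b] by auto
    qed
  qed
  then show ?thesis
    unfolding card_length_sum_list[symmetric] by (rule bij_betw_same_card)
qed

text \<open>An infinite set has cardinality 0, whereas the binomial coefficient is positive.\<close>

lemma finite_mono_degree_eq: "finite {b :: 'v::finite \<Rightarrow>\<^sub>0 nat. mono_degree b = q}"
proof -
  have "q \<le> q + CARD('v) - 1"
    using zero_less_card_finite[where 'a = 'v] by linarith
  then have "card {b :: 'v \<Rightarrow>\<^sub>0 nat. mono_degree b = q} > 0"
    unfolding card_mono_degree_eq by (rule zero_less_binomial)
  then show ?thesis
    by (rule card_ge_0_finite)
qed

section \<open>The resolution\<close>

lemma lookup_scale: "Poly_Mapping.lookup (Poly_Mapping.single 0 s * p) b = s * Poly_Mapping.lookup p b"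
  for p :: "'a::monoid_add \<Rightarrow>\<^sub>0 'b::semiring_0"
  unfolding mult_map_scale_conv_mult[symmetric] by (simp add: Poly_Mapping.map.rep_eq when_def)

text \<open>The strand of \<open>T\<close>-degree \<open>k\<close> of the Koszul complex over \<open>S[T]\<close> on the elements
  \<open>z s = xT (en s) - xT (en m)\<close>, \<open>s < m\<close>. Its term of homological degree \<open>j\<close> is free over \<open>S\<close> on the pairs \<open>(A, b)\<close>
  standing for \<open>T\<close> to the power \<open>b\<close> times the basis vector \<open>e\<^sub>A\<close>.\<close>

locale koszul_strand =
  fixes en :: "nat \<Rightarrow> 'v::finite" and m k :: nat
  assumes en: "bij_betw en {..<Suc m} UNIV" and m_ge_1: "m \<ge> 1"
begin

section \<open>Bases and ranks of the strand\<close>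

definition z :: "nat \<Rightarrow> ('v, 'k::comm_ring_1) mpoly2" where
  "z s = xT (en s) - xT (en m)"

definition basis_set :: "nat \<Rightarrow> (nat set \<times> ('v \<Rightarrow>\<^sub>0 nat)) set" where
  "basis_set j = {A. A \<subseteq> {..<m} \<and> card A = j} \<times> {b. mono_degree b + j = k}"

definition basis :: "nat \<Rightarrow> (nat set \<times> ('v \<Rightarrow>\<^sub>0 nat)) list" where
  "basis j = (SOME xs. set xs = basis_set j \<and> distinct xs)"

text \<open>The claimed Betti number for \<open>n = Suc m\<close> at index \<open>Suc j\<close>: the
  strand resolves the power of the ideal, which shifts the index by one against the
  quotient.\<close>

definition rk :: "nat \<Rightarrow> nat" where
  "rk j = ((Suc m + k - Suc j) choose m) * (m choose j)"

lemma finite_basis_set: "finite (basis_set j)"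
proof -
  have "finite {b :: 'v \<Rightarrow>\<^sub>0 nat. mono_degree b + j = k}"
    by (rule finite_subset[OF _ finite_mono_degree_eq[of "k - j"]]) auto
  then show ?thesis
    by (simp add: basis_set_def)
qed

lemma basis: "set (basis j) = basis_set j" "distinct (basis j)"
  using someI_ex[OF finite_distinct_list[OF finite_basis_set, of j]]
  unfolding basis_def by auto

lemma length_basis [simp]: "length (basis j) = rk j"
proof -
  have CARD: "CARD('v) = Suc m"
    using bij_betw_same_card[OF en] by simp
  have "card {b :: 'v \<Rightarrow>\<^sub>0 nat. mono_degree b + j = k} = (Suc m + k - Suc j) choose m"
  proof (cases "j \<le> k")
    case True
    then have "{b :: 'v \<Rightarrow>\<^sub>0 nat. mono_degree b + j = k} = {b. mono_degree b = k - j}"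
      by auto
    then have "card {b :: 'v \<Rightarrow>\<^sub>0 nat. mono_degree b + j = k} = (k - j + m) choose (k - j)"
      by (simp add: card_mono_degree_eq CARD)
    also have "\<dots> = (k - j + m) choose m"
      using binomial_symmetric[of "k - j" "k - j + m"] by simp
    finally show ?thesis
      using True by (simp add: add.commute)
  next
    case False
    then have "{b :: 'v \<Rightarrow>\<^sub>0 nat. mono_degree b + j = k} = {}"
      by auto
    \<comment> \<open>\<open>m \<ge> 1\<close> covers the case in which the subtraction is cut off
      at 0.\<close>
    moreover have "Suc m + k - Suc j < m"
      using False m_ge_1 by linarith
    ultimately show ?thesis
      by (simp add: binomial_eq_0)
  qed
  moreover have "length (basis j) = card (basis_set j)"
    using distinct_card[OF basis(2), of j] by (simp add: basis(1))
  ultimately show ?thesis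
    by (simp add: rk_def basis_set_def card_cartesian_product n_subsets)
qed

lemma basis_nth:
  assumes "l < rk j"
  shows "fst (basis j ! l) \<subseteq> {..<m}" "card (fst (basis j ! l)) = j"
    "mono_degree (snd (basis j ! l)) + j = k"
  using nth_mem[of l "basis j"] assms unfolding length_basis basis by (auto simp: basis_set_def)

section \<open>Coordinates of homogeneous chains\<close>

definition basis_chain :: "nat \<Rightarrow> nat \<Rightarrow> nat set \<Rightarrow> ('v, 'k::comm_ring_1) mpoly2" where
  "basis_chain j l A = (if fst (basis j ! l) = A then Poly_Mapping.single (snd (basis j ! l)) 1 else 0)"

text \<open>\<open>chain\<close> and \<open>coords\<close> identify vectors over \<open>S\<close>
  with homogeneous chains, as far as values on \<open>j\<close>-subsets of \<open>{..<m}\<close> are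
  concerned.\<close>

definition chain :: "nat \<Rightarrow> ('v, 'k::comm_ring_1) mpolynomial vec \<Rightarrow> nat set \<Rightarrow> ('v, 'k) mpoly2" where
  "chain j v A = (\<Sum>l<rk j. Poly_Mapping.single 0 (v $ l) * basis_chain j l A)"

definition coords :: "nat \<Rightarrow> (nat set \<Rightarrow> ('v, 'k::comm_ring_1) mpoly2) \<Rightarrow> ('v, 'k) mpolynomial vec" where
  "coords j c = vec (rk j) (\<lambda>l. Poly_Mapping.lookup (c (fst (basis j ! l))) (snd (basis j ! l)))"

text \<open>Membership in the strand: \<open>e_A\<close> itself counts for \<open>T\<close>-degree
  \<open>j\<close>. The additive form forces the coefficients to vanish when
  \<open>j > k\<close>.\<close>

definition homogeneous_chain :: "nat \<Rightarrow> (nat set \<Rightarrow> ('v, 'k::comm_ring_1) mpoly2) \<Rightarrow> bool" where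
  "homogeneous_chain j c \<longleftrightarrow>
     (\<forall>A. A \<subseteq> {..<m} \<longrightarrow> card A = j \<longrightarrow> (\<forall>b. Poly_Mapping.lookup (c A) b \<noteq> 0 \<longrightarrow> mono_degree b + j = k))"

lemma lookup_chain:
  "Poly_Mapping.lookup (chain j v A) b = (\<Sum>l<rk j. if basis j ! l = (A, b) then v $ l else 0)"
  unfolding chain_def lookup_sum lookup_scale
  by (intro sum.cong refl) (auto simp: basis_chain_def lookup_single when_def prod_eq_iff)

lemma lookup_chain_nth:
  assumes "l < rk j"
  shows "Poly_Mapping.lookup (chain j v (fst (basis j ! l))) (snd (basis j ! l)) = v $ l"
proof -
  have "Poly_Mapping.lookup (chain j v (fst (basis j ! l))) (snd (basis j ! l)) =
      (\<Sum>l'<rk j. if l' = l then v $ l' else 0)"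
    unfolding lookup_chain using assms basis(2)[of j]
    by (intro sum.cong refl) (auto simp: nth_eq_iff_index_eq)
  then show ?thesis
    using assms by simp
qed

lemma lookup_chain_notin:
  assumes "(A, b) \<notin> basis_set j"
  shows "Poly_Mapping.lookup (chain j v A) b = 0"
proof -
  have "basis j ! l \<noteq> (A, b)" if "l < rk j" for l
    using nth_mem[of l "basis j"] that assms by (auto simp: basis)
  then show ?thesis
    unfolding lookup_chain by (intro sum.neutral) simp
qed

lemma coords_carrier [simp]: "coords j c \<in> carrier_vec (rk j)"
  by (simp add: coords_def)

lemma coords_chain:
  assumes "v \<in> carrier_vec (rk j)"
  shows "coords j (chain j v) = v"
  using assms by (intro eq_vecI) (auto simp: coords_def lookup_chain_nth)

lemma homogeneous_chain_chain: "homogeneous_chain j (chain j v)"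
  unfolding homogeneous_chain_def using lookup_chain_notin[of _ _ j v]
  by (fastforce simp: basis_set_def)

lemma chain_coords:
  assumes "homogeneous_chain j c" and "A \<subseteq> {..<m}" and "card A = j"
  shows "chain j (coords j c) A = c A"
proof (rule poly_mapping_eqI)
  fix b
  show "Poly_Mapping.lookup (chain j (coords j c) A) b = Poly_Mapping.lookup (c A) b"
  proof (cases "(A, b) \<in> basis_set j")
    case True
    then obtain l where "l < rk j" "basis j ! l = (A, b)"
      by (metis basis(1) in_set_conv_nth length_basis)
    then show ?thesis
      using lookup_chain_nth[of l j "coords j c"] by (simp add: coords_def)
  next
    case False
    then have "Poly_Mapping.lookup (c A) b = 0"
      using assms unfolding homogeneous_chain_def basis_set_def by blast
    then show ?thesis
      using False by (simp add: lookup_chain_notin)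
  qed
qed

lemma coords_cong:
  assumes "\<And>A. A \<subseteq> {..<m} \<Longrightarrow> card A = j \<Longrightarrow> c A = c' A"
  shows "coords j c = coords j c'"
  unfolding coords_def using assms basis_nth by (intro eq_vecI) simp_all

lemma coords_eq_0_imp:
  assumes "homogeneous_chain j c" and "A \<subseteq> {..<m}" and "card A = j" and "coords j c = 0\<^sub>v (rk j)"
  shows "c A = 0"
proof -
  have "chain j (0\<^sub>v (rk j)) A = (0 :: ('v, 'a) mpoly2)"
    by (simp add: chain_def)
  then show ?thesis
    using chain_coords[OF assms(1-3)] assms(4) by simp
qed

section \<open>Projection onto the strand\<close>

definition truncate :: "(nat set \<Rightarrow> ('v, 'k::comm_ring_1) mpoly2) \<Rightarrow> nat set \<Rightarrow> ('v, 'k) mpoly2" where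
  "truncate c A = T_part (int k - int (card A)) (c A)"

lemma homogeneous_chain_truncate: "homogeneous_chain j (truncate c)"
  by (auto simp: homogeneous_chain_def truncate_def lookup_T_part when_def split: if_splits)

lemma truncate_homogeneous:
  assumes "homogeneous_chain j c" and "A \<subseteq> {..<m}" and "card A = j"
  shows "truncate c A = c A"
proof (rule poly_mapping_eqI)
  fix b
  have "Poly_Mapping.lookup (c A) b \<noteq> 0 \<longrightarrow> mono_degree b + j = k"
    using assms unfolding homogeneous_chain_def by blast
  then show "Poly_Mapping.lookup (truncate c A) b = Poly_Mapping.lookup (c A) b"
    using assms(3) by (auto simp: truncate_def lookup_T_part when_def)
qed

text \<open>Each \<open>z s\<close> has \<open>T\<close>-degree 1 and \<open>insert s B\<close> has
  one element more than \<open>B\<close>, so the differential preserves total degree.\<close>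

lemma koszul_truncate:
  assumes "B \<subseteq> {..<m}"
  shows "koszul m z (truncate c) B = truncate (koszul m z c) B"
proof -
  have fin: "finite B"
    using assms finite_subset by blast
  have sign: "T_part q ((-1) ^ e * p) = (-1) ^ e * T_part q p" for q e and p :: "('v, 'a) mpoly2"
    by (cases "even e") (auto simp: additive.minus[OF additive_T_part])
  show ?thesis
    unfolding truncate_def koszul_def additive.sum[OF additive_T_part] mult.assoc sign
  proof (intro sum.cong refl)
    fix s assume "s \<in> {..<m} - B"
    then have "int k - int (card (insert s B)) = int k - int (card B) - 1"
      using fin by simp
    then show "(-1) ^ card (B \<inter> {..<s}) * (z s * T_part (int k - int (card (insert s B))) (c (insert s B))) =
        (-1) ^ card (B \<inter> {..<s}) * T_part (int k - int (card B)) (z s * c (insert s B))"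
      unfolding z_def T_part_xT_diff by (simp only:)
  qed
qed

lemma homogeneous_chain_koszul:
  assumes "homogeneous_chain (Suc j) c"
  shows "homogeneous_chain j (koszul m z c)"
proof -
  have "koszul m z c A = truncate (koszul m z c) A" if "A \<subseteq> {..<m}" "card A = j" for A
  proof -
    have "koszul m z c A = koszul m z (truncate c) A"
      using truncate_homogeneous[OF assms] that by (intro koszul_cong_card[of _ j]) auto
    then show ?thesis
      using koszul_truncate[OF that(1)] by simp
  qed
  then show ?thesis
    using homogeneous_chain_truncate[of j "koszul m z c"] by (simp add: homogeneous_chain_def)
qed

section \<open>The differentials as matrices\<close>

fun rank :: "nat \<Rightarrow> nat" where
  "rank 0 = 1"
| "rank (Suc j) = rk j"

text \<open>The strand augmented to \<open>S\<close>: matrix 0 is the row of generators of the power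
  of the ideal, the later ones are the Koszul differentials in coordinates.\<close>

fun diff_mat :: "nat \<Rightarrow> ('v, 'k::comm_ring_1) mpolynomial mat" where
  "diff_mat 0 = mat 1 (rk 0) (\<lambda>(_, l). Poly_Mapping.single (gen_exp (snd (basis 0 ! l))) 1)"
| "diff_mat (Suc j) = mat (rk j) (rk (Suc j)) (\<lambda>(i, l). coords j (koszul m z (basis_chain (Suc j) l)) $ i)"

text \<open>The generators of the \<open>k\<close>-th power have degree \<open>k * m\<close>, and
  each later differential is linear.\<close>

fun shift :: "nat \<Rightarrow> nat \<Rightarrow> int" where
  "shift 0 _ = 0"
| "shift (Suc j) _ = int (k * m + j)"

lemma diff_mat_carrier: "diff_mat j \<in> carrier_mat (rank j) (rank (Suc j))"
  by (cases j) auto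

text \<open>The only basis set in degree 0 is \<open>{}\<close>, so a vector amounts to one
  polynomial of \<open>T\<close>-degree \<open>k\<close> and the augmentation is the Rees map on
  it.\<close>

lemma diff_mat_0_mult:
  assumes v: "v \<in> carrier_vec (rk 0)"
  shows "diff_mat 0 *\<^sub>v v = vec 1 (\<lambda>_. rees_map (chain 0 v {}))"
proof -
  have "fst (basis 0 ! l) = {}" if "l < rk 0" for l
    using basis_nth(1,2)[OF that] finite_subset by fastforce
  then have "rees_map (chain 0 v {}) =
      (\<Sum>l<rk 0. rees_map (Poly_Mapping.single (snd (basis 0 ! l)) (v $ l)))"
    unfolding chain_def additive.sum[OF additive_rees_map]
    by (intro sum.cong refl) (simp add: basis_chain_def mult_single)
  also have "\<dots> = (\<Sum>l<rk 0. Poly_Mapping.single (gen_exp (snd (basis 0 ! l))) 1 * v $ l)"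
    by (intro sum.cong refl) (simp add: rees_map_def extend_single mult.commute)
  finally show ?thesis
    using v by (intro eq_vecI) (auto simp: scalar_prod_def atLeast0LessThan)
qed

lemma diff_mat_Suc_mult:
  assumes v: "v \<in> carrier_vec (rk (Suc j))"
  shows "diff_mat (Suc j) *\<^sub>v v = coords j (koszul m z (chain (Suc j) v))"
proof (rule eq_vecI)
  fix i assume "i < dim_vec (coords j (koszul m z (chain (Suc j) v)))"
  then have i: "i < rk j" by (simp add: coords_def)
  have "koszul m z (chain (Suc j) v) B =
      (\<Sum>l<rk (Suc j). Poly_Mapping.single 0 (v $ l) * koszul m z (basis_chain (Suc j) l) B)" for B
    unfolding chain_def koszul_sum koszul_mult ..
  then have "coords j (koszul m z (chain (Suc j) v)) $ i =
      (\<Sum>l<rk (Suc j). v $ l * coords j (koszul m z (basis_chain (Suc j) l)) $ i)"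
    using i by (simp add: coords_def lookup_sum lookup_scale)
  then show "(diff_mat (Suc j) *\<^sub>v v) $ i = coords j (koszul m z (chain (Suc j) v)) $ i"
    using i v by (simp add: scalar_prod_def atLeast0LessThan mult.commute)
qed (simp add: coords_def)

text \<open>The bounding chain \<open>c\<close> may have mixed \<open>T\<close>-degrees; its
  truncation bounds the same homogeneous chain and has coordinates.\<close>

lemma in_image_diff_mat_Suc:
  assumes v: "v \<in> carrier_vec (rk j)"
    and c: "\<And>A. A \<subseteq> {..<m} \<Longrightarrow> card A = j \<Longrightarrow> chain j v A = koszul m z c A"
  shows "v \<in> mat_image (diff_mat (Suc j))"
proof -
  define w where "w = coords (Suc j) (truncate c)"
  have "koszul m z (chain (Suc j) w) A = chain j v A" if A: "A \<subseteq> {..<m}" "card A = j" for A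
  proof -
    have "koszul m z (chain (Suc j) w) A = koszul m z (truncate c) A"
      unfolding w_def using A chain_coords[OF homogeneous_chain_truncate]
      by (intro koszul_cong_card[of _ j]) auto
    also have "\<dots> = truncate (chain j v) A"
      using koszul_truncate[OF A(1)] c[OF A] by (simp add: truncate_def)
    finally show ?thesis
      using truncate_homogeneous[OF homogeneous_chain_chain A] by simp
  qed
  then have "diff_mat (Suc j) *\<^sub>v w = coords j (chain j v)"
    unfolding diff_mat_Suc_mult[of w, unfolded w_def, OF coords_carrier, folded w_def]
    by (rule coords_cong)
  then have "diff_mat (Suc j) *\<^sub>v w = v"
    by (simp only: coords_chain[OF v])
  moreover have "w \<in> carrier_vec (dim_col (diff_mat (Suc j) :: ('v, 'a) mpolynomial mat))"
    by (simp add: w_def)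
  ultimately show ?thesis
    unfolding mat_image_def by (metis imageI)
qed

lemma chain_image_diff_mat_Suc:
  assumes "v \<in> mat_image (diff_mat (Suc j))"
  shows "v \<in> carrier_vec (rk j)"
    and "\<exists>w. \<forall>A. A \<subseteq> {..<m} \<longrightarrow> card A = j \<longrightarrow> chain j v A = koszul m z (chain (Suc j) w) A"
proof -
  obtain w where w: "w \<in> carrier_vec (rk (Suc j))" and v: "v = diff_mat (Suc j) *\<^sub>v w"
    using assms unfolding mat_image_def by auto
  show "v \<in> carrier_vec (rk j)"
    unfolding v diff_mat_Suc_mult[OF w] by simp
  have "chain j v A = koszul m z (chain (Suc j) w) A" if "A \<subseteq> {..<m}" "card A = j" for A
    unfolding v diff_mat_Suc_mult[OF w]
    using homogeneous_chain_koszul[OF homogeneous_chain_chain] that by (rule chain_coords)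
  then show "\<exists>w. \<forall>A. A \<subseteq> {..<m} \<longrightarrow> card A = j \<longrightarrow> chain j v A = koszul m z (chain (Suc j) w) A"
    by blast
qed

section \<open>Exactness\<close>

text \<open>The division properties that \<open>koszul_exact\<close> asks for; injectivity of
  \<open>en\<close> keeps the variables involved distinct.\<close>

lemma xT_quot_z:
  "s < m \<Longrightarrow> xT_quot (en m) (en s) (z s * p) = p"
  "s < m \<Longrightarrow> t < m \<Longrightarrow> s \<noteq> t \<Longrightarrow> xT_quot (en m) (en s) (z t * p) = z t * xT_quot (en m) (en s) p"
proof -
  have inj: "en s = en t \<longleftrightarrow> s = t" if "s \<le> m" "t \<le> m" for s t
    using that bij_betw_imp_inj_on[OF en] by (auto dest: inj_onD)
  show "s < m \<Longrightarrow> xT_quot (en m) (en s) (z s * p) = p"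
    unfolding z_def by (rule xT_quot_cancel) (simp add: inj)
  show "s < m \<Longrightarrow> t < m \<Longrightarrow> s \<noteq> t \<Longrightarrow> xT_quot (en m) (en s) (z t * p) = z t * xT_quot (en m) (en s) p"
    unfolding z_def by (rule xT_quot_commute) (simp_all add: inj)
qed

text \<open>A boundary of a homogeneous chain is homogeneous, so zero coordinates make it zero.
  Koszul exactness over \<open>S[T]\<close> then gives a bounding chain, which is truncated to the
  strand.\<close>

lemma exact_Suc: "mat_kernel (diff_mat (Suc j)) = mat_image (diff_mat (Suc (Suc j)))"
proof (intro subset_antisym subsetI)
  fix v assume "v \<in> mat_kernel (diff_mat (Suc j))"
  then have v: "v \<in> carrier_vec (rk (Suc j))" and 0: "diff_mat (Suc j) *\<^sub>v v = 0\<^sub>v (rk j)"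
    by (auto simp: mat_kernel_def)
  have "koszul m z (chain (Suc j) v) B = 0" if "B \<subseteq> {..<m}" "card B = j" for B
    using homogeneous_chain_koszul[OF homogeneous_chain_chain] that 0[unfolded diff_mat_Suc_mult[OF v]]
    by (rule coords_eq_0_imp)
  then have "\<exists>c'. \<forall>A. A \<subseteq> {..<m} \<longrightarrow> card A = Suc j \<longrightarrow> chain (Suc j) v A = koszul m z c' A"
    using additive.add[OF additive_xT_quot] xT_quot_z
    by (intro koszul_exact[where \<sigma> = "\<lambda>s. xT_quot (en m) (en s)"]) auto
  then show "v \<in> mat_image (diff_mat (Suc (Suc j)))"
    using in_image_diff_mat_Suc[OF v] by blast
next
  fix v :: "('v, 'a) mpolynomial vec" assume "v \<in> mat_image (diff_mat (Suc (Suc j)))"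
  then obtain w where v: "v \<in> carrier_vec (rk (Suc j))"
    and w: "\<And>A. A \<subseteq> {..<m} \<Longrightarrow> card A = Suc j \<Longrightarrow> chain (Suc j) v A = koszul m z (chain (Suc (Suc j)) w) A"
    using chain_image_diff_mat_Suc by blast
  have "koszul m z (chain (Suc j) v) B = 0" if "B \<subseteq> {..<m}" "card B = j" for B
  proof -
    have "koszul m z (chain (Suc j) v) B = koszul m z (koszul m z (chain (Suc (Suc j)) w)) B"
      using w that by (intro koszul_cong_card[of _ j]) auto
    then show ?thesis
      using koszul_koszul[OF that(1)] by simp
  qed
  then have "diff_mat (Suc j) *\<^sub>v v = coords j (\<lambda>_. 0)"
    unfolding diff_mat_Suc_mult[OF v] by (rule coords_cong)
  also have "\<dots> = 0\<^sub>v (rk j)"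
    by (intro eq_vecI) (auto simp: coords_def)
  finally show "v \<in> mat_kernel (diff_mat (Suc j))"
    using v by (simp add: mat_kernel_def)
qed

lemma koszul_empty: "koszul m z c {} = (\<Sum>s<m. z s * c {s})"
  by (simp add: koszul_def)

lemma range_xT_diff: "range (\<lambda>v. xT v - xT (en m)) = z ` {..<Suc m}"
  unfolding z_def bij_betw_imp_surj_on[OF en, symmetric] image_image ..

text \<open>The generator for \<open>s = m\<close> is \<open>z m = 0\<close>, which leaves the
  \<open>m\<close> elements of the Koszul complex.\<close>

lemma rees_ideal_eq: "rees_ideal (en m) = range (\<lambda>u. \<Sum>s<m. z s * u s)"
  unfolding rees_ideal_def range_xT_diff ideal_generated_by_image[OF finite_lessThan] sum.lessThan_Suc
  by (simp add: z_def)

lemma exact_0: "mat_kernel (diff_mat 0) = mat_image (diff_mat (Suc 0))"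
proof (intro subset_antisym subsetI)
  fix v :: "('v, 'a) mpolynomial vec" assume "v \<in> mat_kernel (diff_mat 0)"
  then have v: "v \<in> carrier_vec (rk 0)" and 0: "diff_mat 0 *\<^sub>v v = 0\<^sub>v 1"
    by (auto simp: mat_kernel_def)
  have "rees_map (chain 0 v {}) = (diff_mat 0 *\<^sub>v v) $ 0"
    unfolding diff_mat_0_mult[OF v] by simp
  then have "rees_map (chain 0 v {}) = 0"
    unfolding 0 by simp
  moreover have "mono_degree b = k" if "b \<in> Poly_Mapping.keys (chain 0 v {})" for b
    using homogeneous_chain_chain[of 0 v] that by (auto simp: homogeneous_chain_def in_keys_iff)
  ultimately have "chain 0 v {} \<in> rees_ideal (en m)"
    by (intro rees_map_kernel)
  then obtain u where u: "chain 0 v {} = (\<Sum>s<m. z s * u s)"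
    unfolding rees_ideal_eq by blast
  show "v \<in> mat_image (diff_mat (Suc 0))"
  proof (rule in_image_diff_mat_Suc[OF v])
    fix A :: "nat set" assume "A \<subseteq> {..<m}" "card A = 0"
    then have "A = {}" using finite_subset by fastforce
    \<comment> \<open>A 1-chain lives on singletons; \<open>the_elem\<close> turns the family
      \<open>u\<close> into a function on sets.\<close>
    then show "chain 0 v A = koszul m z (\<lambda>A. u (the_elem A)) A"
      by (simp add: u koszul_empty)
  qed
next
  fix v :: "('v, 'a) mpolynomial vec" assume "v \<in> mat_image (diff_mat (Suc 0))"
  then obtain w where v: "v \<in> carrier_vec (rk 0)"
    and w: "\<And>A. A \<subseteq> {..<m} \<Longrightarrow> card A = 0 \<Longrightarrow> chain 0 v A = koszul m z (chain (Suc 0) w) A"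
    using chain_image_diff_mat_Suc by blast
  have "rees_map (chain 0 v {}) = 0"
    using w[of "{}"] by (simp add: koszul_empty additive.sum[OF additive_rees_map] z_def rees_map_xT_diff)
  then have "diff_mat 0 *\<^sub>v v = 0\<^sub>v 1"
    unfolding diff_mat_0_mult[OF v] by (intro eq_vecI) auto
  then show "v \<in> mat_kernel (diff_mat 0)"
    using v by (simp add: mat_kernel_def)
qed

lemma image_diff_mat_0:
  "(\<lambda>v. v $ 0) ` mat_image (diff_mat 0) =
    ideal_generated_by ((\<lambda>b. Poly_Mapping.single (gen_exp b) 1) ` {b. mono_degree b = k})"
proof -
  let ?g = "\<lambda>b. Poly_Mapping.single (gen_exp b) (1::'a)"
  have "snd ` (basis_set 0 :: (nat set \<times> ('v \<Rightarrow>\<^sub>0 nat)) set) = {b. mono_degree b = k}"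
    by (force simp: basis_set_def)
  then have "{b. mono_degree b = k} = snd ` (!) (basis 0) ` {..<rk 0}"
    unfolding basis(1)[symmetric] using nth_image[of "rk 0" "basis 0"] by (simp add: lessThan_atLeast0)
  then have "?g ` {b. mono_degree b = k} = (\<lambda>l. ?g (snd (basis 0 ! l))) ` {..<rk 0}"
    by (simp add: image_image)
  then have "ideal_generated_by (?g ` {b. mono_degree b = k}) =
      range (\<lambda>u. \<Sum>l<rk 0. ?g (snd (basis 0 ! l)) * u l)"
    by (simp only: ideal_generated_by_image[OF finite_lessThan])
  also have "\<dots> = (\<lambda>v. v $ 0) ` mat_image (diff_mat 0)"
  proof (intro subset_antisym subsetI)
    fix p assume "p \<in> range (\<lambda>u. \<Sum>l<rk 0. ?g (snd (basis 0 ! l)) * u l)"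
    then obtain u where "p = (\<Sum>l<rk 0. ?g (snd (basis 0 ! l)) * u l)" by blast
    then have "p = (diff_mat 0 *\<^sub>v vec (rk 0) u) $ 0"
      by (simp add: scalar_prod_def atLeast0LessThan)
    then show "p \<in> (\<lambda>v. v $ 0) ` mat_image (diff_mat 0)"
      unfolding mat_image_def by (intro image_eqI[OF _ imageI]) auto
  next
    fix p assume "p \<in> (\<lambda>v. v $ 0) ` mat_image (diff_mat 0 :: ('v, 'a) mpolynomial mat)"
    then obtain v where "v \<in> carrier_vec (rk 0)" "p = (diff_mat 0 *\<^sub>v v) $ 0"
      unfolding mat_image_def by auto
    then have "p = (\<Sum>l<rk 0. ?g (snd (basis 0 ! l)) * v $ l)"
      by (simp add: scalar_prod_def atLeast0LessThan)
    then show "p \<in> range (\<lambda>u. \<Sum>l<rk 0. ?g (snd (basis 0 ! l)) * u l)"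
      by (rule range_eqI[where x = "($) v"])
  qed
  finally show ?thesis ..
qed

end

section \<open>Linear entries and minimality\<close>

lemma homogeneous_of_degree_iff:
  "homogeneous_of_degree e p \<longleftrightarrow> (\<forall>b. Poly_Mapping.lookup p b \<noteq> 0 \<longrightarrow> int (mono_degree b) = e)"
  by (auto simp: homogeneous_of_degree_def in_keys_iff)

text \<open>Bundles the two requirements on matrix entries, degree 1 and minimality, into one
  additive group, so that both pass through the Koszul sum together.\<close>

definition linear_forms :: "('v::finite, 'k::comm_ring_1) mpolynomial set" where
  "linear_forms = {p. homogeneous_of_degree 1 p \<and> p \<in> irrelevant_ideal}"

lemma linear_forms_diff:
  assumes "p \<in> linear_forms" and "q \<in> linear_forms"
  shows "p - q \<in> linear_forms"
proof -
  have "p - q \<in> irrelevant_ideal"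
    using assms self_module.span_diff unfolding linear_forms_def irrelevant_ideal_def by blast
  moreover have "int (mono_degree b) = 1" if "Poly_Mapping.lookup (p - q) b \<noteq> 0" for b
  proof -
    have "Poly_Mapping.lookup p b \<noteq> 0 \<or> Poly_Mapping.lookup q b \<noteq> 0"
      using that by (auto simp: lookup_minus)
    then show ?thesis
      using assms unfolding linear_forms_def homogeneous_of_degree_iff by blast
  qed
  ultimately show ?thesis
    unfolding linear_forms_def homogeneous_of_degree_iff by blast
qed

lemma linear_forms_0: "0 \<in> linear_forms"
  by (simp add: linear_forms_def irrelevant_ideal_def homogeneous_of_degree_def self_module.span_zero)

lemma linear_forms_minus: "p \<in> linear_forms \<Longrightarrow> - p \<in> linear_forms"
  using linear_forms_diff[OF linear_forms_0] by simp

lemma linear_forms_sum: "(\<And>x. x \<in> X \<Longrightarrow> f x \<in> linear_forms) \<Longrightarrow> sum f X \<in> linear_forms"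
proof (induction X rule: infinite_finite_induct)
  case (insert x X)
  then have "f x - (- sum f X) \<in> linear_forms"
    by (intro linear_forms_diff linear_forms_minus) auto
  with insert show ?case by simp
qed (simp_all add: linear_forms_0)

lemma linear_forms_expo: "Poly_Mapping.single (expo v) 1 \<in> linear_forms"
  unfolding linear_forms_def irrelevant_ideal_def homogeneous_of_degree_iff
  by (auto simp: lookup_single when_def intro!: self_module.span_base)

lemma single_in_irrelevant_ideal:
  assumes "e \<noteq> 0"
  shows "Poly_Mapping.single e (1::'k::comm_ring_1) \<in> irrelevant_ideal"
proof -
  obtain v e' where "e = expo v + e'"
    using obtain_expo_add[OF assms] by blast
  then have "Poly_Mapping.single e (1::'k) = Poly_Mapping.single e' 1 * Poly_Mapping.single (expo v) 1"
    by (simp add: mult_single add.commute)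
  then show ?thesis
    unfolding irrelevant_ideal_def by (simp only:) (intro self_module.span_scale self_module.span_base, blast)
qed

text \<open>The coefficient is \<open>x_v\<close> or 0.\<close>

lemma lookup_xT_single: "Poly_Mapping.lookup (xT v * Poly_Mapping.single e 1) e' \<in> linear_forms"
  by (simp add: xT_def bimono_def mult_single lookup_single when_def linear_forms_0
      linear_forms_expo[unfolded One_nat_def])

context koszul_strand
begin

lemma lookup_z_basis_chain: "Poly_Mapping.lookup (z s * basis_chain j l A) e \<in> linear_forms"
  unfolding z_def basis_chain_def left_diff_distrib lookup_minus
  by (auto intro!: linear_forms_diff lookup_xT_single simp: linear_forms_0)

lemma lookup_koszul_basis_chain: "Poly_Mapping.lookup (koszul m z (basis_chain j l) B) e \<in> linear_forms"
  unfolding koszul_def lookup_sum mult.assoc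
proof (rule linear_forms_sum)
  show "Poly_Mapping.lookup ((-1) ^ i * (z s * basis_chain j l A)) e \<in> linear_forms" for i s A
    by (cases "even i") (simp_all add: lookup_z_basis_chain linear_forms_minus)
qed

lemma diff_mat_Suc_linear_forms:
  assumes "a < rank (Suc j)" and "b < rank (Suc (Suc j))"
  shows "diff_mat (Suc j) $$ (a, b) \<in> linear_forms"
  using assms by (simp add: coords_def lookup_koszul_basis_chain)

lemma minimal_resolution:
  assumes "k \<ge> 1"
  shows "minimal_graded_free_resolution
    (ideal_power (squarefree_ideal m :: ('v, 'k::comm_ring_1) mpolynomial set) k) rank shift diff_mat"
proof -
  have CARD: "CARD('v) = Suc m"
    using bij_betw_same_card[OF en] by simp
  have deg: "mono_degree (gen_exp (snd (basis 0 ! b))) = k * m" if "b < rk 0" for b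
    using mono_degree_gen_exp[of "snd (basis 0 ! b)"] basis_nth(3)[OF that] by (simp add: CARD)
  \<comment> \<open>\<open>k \<ge> 1\<close> and \<open>m \<ge> 1\<close> make the degree
    \<open>k * m\<close> positive, so the entries of the augmentation row lie in the irrelevant
    ideal.\<close>
  have ne: "gen_exp (snd (basis 0 ! b)) \<noteq> 0" if "b < rk 0" for b
    using deg[OF that] assms m_ge_1 by (metis mono_degree_0 mult_is_0 not_one_le_zero)
  have "homogeneous_of_degree (shift (Suc i) b - shift i a) (diff_mat i $$ (a, b) :: ('v, 'k) mpolynomial) \<and>
      (diff_mat i $$ (a, b) :: ('v, 'k) mpolynomial) \<in> irrelevant_ideal"
    if "a < rank i" "b < rank (Suc i)" for i a b
  proof (cases i)
    case 0
    then show ?thesis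
      using that deg ne single_in_irrelevant_ideal
      by (auto simp: homogeneous_of_degree_iff lookup_single when_def)
  next
    case (Suc j)
    have "(diff_mat i $$ (a, b) :: ('v, 'k) mpolynomial) \<in> linear_forms"
      using that unfolding Suc by (rule diff_mat_Suc_linear_forms)
    then show ?thesis
      by (simp add: linear_forms_def Suc)
  qed
  moreover have "mat_kernel (diff_mat i) = mat_image (diff_mat (Suc i) :: ('v, 'k) mpolynomial mat)" for i
    using exact_0 exact_Suc by (cases i) auto
  moreover have "(\<lambda>v. v $ 0) ` mat_image (diff_mat 0) =
      ideal_power (squarefree_ideal m :: ('v, 'k) mpolynomial set) k"
    unfolding image_diff_mat_0 by (rule ideal_power_squarefree_ideal_codim1[symmetric]) (simp add: CARD)
  ultimately show ?thesis
    unfolding minimal_graded_free_resolution_def graded_free_resolution_def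
    using diff_mat_carrier by auto
qed

end

theorem theorem3p8:
  fixes I :: "('v::finite, 'k::field) mpolynomial set" and n k i :: nat
  assumes "n = CARD('v)" and "n \<ge> 2"
    and "I = squarefree_ideal (n - 1)"
    and "k \<ge> 1" and "1 \<le> i" and "i \<le> n"
  shows "betti_number (ideal_power I k) i = ((n + k - i) choose (n - 1)) * ((n - 1) choose (i - 1))"
proof -
  obtain m where m: "n = Suc m"
    using assms(2) by (cases n) auto
  obtain j where j: "i = Suc j"
    using assms(5) by (cases i) auto
  \<comment> \<open>Any enumeration of the variables will do; its last one, \<open>en m\<close>,
    becomes the fixed variable \<open>w\<close>.\<close>
  obtain en :: "nat \<Rightarrow> 'v" where "bij_betw en {..<Suc m} UNIV"
    using ex_bij_betw_nat_finite[of "UNIV :: 'v set"] assms(1) m by (auto simp: lessThan_atLeast0)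
  then interpret koszul_strand en m k
    using assms(2) m by unfold_locales auto
  have I: "I = squarefree_ideal m"
    using assms(3) m by simp
  have "betti_number (ideal_power I k) i = rank i"
    unfolding I using assms(4) by (rule betti_number_eq[OF minimal_resolution])
  then show ?thesis
    using m j by (simp add: rk_def)
qed

end
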